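(* Let $(\boldsymbol Z,\boldsymbol W)$ be random elements of $\mathcal Z\times\mathcal W$ such that $\boldsymbol Z$ is independent of $\boldsymbol W$ and the density $\pi$ of $\boldsymbol Z$ is known and positive everywhere on $\mathcal Z$. Let $K\ge1$ and, for each $k\in[K]$, consider a conditional randomization test given by a finite partition $\mathcal R^{(k)}$ of $\mathcal Z$ and a test statistic $t^{(k)}:\mathcal Z\times\mathcal W\to\mathbb R$, with p-value $P^{(k)}(\boldsymbol Z,\boldsymbol W)$. Suppose that the following two conditions hold. (a) $\underline{\mathcal R}^{\{j,k\}}\subseteq\mathcal R^{\{j,k\}}$ for all $j,k\in[K]$ with $j\ne k$. (b) For all $\mathcal J\subseteq[K]$, the random variables $\left(t^{(j)}(\boldsymbol Z,\boldsymbol W)\right)_{j\in\mathcal J}$ are independent given $\underline{\mathcal G}^{\mathcal J}$ and $\boldsymbol W$; that is, for every $\mathcal S\in\underline{\mathcal R}^{\mathcal J}$ they are mutually independent conditionally on $\boldsymbol Z\in\mathcal S$ and $\boldsymbol W$. Then for any $\alpha^{(1)},\dots,\alpha^{(K)}\in[0,1]$, $$\mathbb P\left\{P^{(1)}(\boldsymbol Z,\boldsymbol W)\le\alpha^{(1)},\dots,P^{(K)}(\boldsymbol Z,\boldsymbol W)\le\alpha^{(K)}\,\middle|\,\overline{\mathcal G}^{[K]},\boldsymbol W\right\}\le\prod_{k=1}^K\alpha^{(k)}.$$ In consequence, for any $\alpha^{(1)},\dots,\alpha^{(K)}\in[0,1]$, $$\mathbb P\left\{P^{(1)}(\boldsymbol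 Z,\boldsymbol W)\le\alpha^{(1)},\dots,P^{(K)}(\boldsymbol Z,\boldsymbol W)\le\alpha^{(K)}\,\middle|\,\boldsymbol W\right\}\le\prod_{k=1}^K\alpha^{(k)}.$$
   Context: $[K]=\{1,\dots,K\}$. $\boldsymbol Z$ is the random treatment assignment with values in $\mathcal Z$; $\boldsymbol W=(\boldsymbol Y(\boldsymbol z):\boldsymbol z\in\mathcal Z)\in\mathcal W$ is the (random) potential outcomes schedule. For each $k\in[K]$, $\mathcal R^{(k)}=\{\mathcal S^{(k)}_m\}_{m=1}^{M^{(k)}}$ is a finite partition of $\mathcal Z$ into nonempty measurable sets ("conditioning sets"), and $\mathcal S^{(k)}_{\boldsymbol z}$ denotes the set in $\mathcal R^{(k)}$ containing $\boldsymbol z\in\mathcal Z$. The p-value of the $k$th test, with $t^{(k)}$ measurable, is $$P^{(k)}(\boldsymbol Z,\boldsymbol W)=\mathbb P\left\{t^{(k)}(\boldsymbol Z^*,\boldsymbol W)\le t^{(k)}(\boldsymbol Z,\boldsymbol W)\mid\boldsymbol Z^*\in\mathcal S^{(k)}_{\boldsymbol Z},\boldsymbol Z,\boldsymbol W\right\},$$ where $\boldsymbol Z^*$ is an independent copy of $\boldsymbol Z$ conditional on $\boldsymbol W$: given $\boldsymbol W$, $\boldsymbol Z^*$ has the same distribution as $\boldsymbol Z$ and is independent of $\boldsymbol Z$. For $\mathcal J\subseteq[K]$ define the union, refinement and coarsening $$\mathcal R^{\mathcal J}=\bigcup_{k\in\mathcal J}\mathcal R^{(k)},\quad\underline{\mathcal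 R}^{\mathcal J}=\Big\{\bigcap_{j\in\mathcal J}\mathcal S^{(j)}_{\boldsymbol z}:\boldsymbol z\in\mathcal Z\Big\},\quad\overline{\mathcal R}^{\mathcal J}=\Big\{\bigcup_{j\in\mathcal J}\mathcal S^{(j)}_{\boldsymbol z}:\boldsymbol z\in\mathcal Z\Big\}$$ (families of subsets of $\mathcal Z$), and the $\sigma$-algebras they generate on $\mathcal Z$: $\underline{\mathcal G}^{\mathcal J}=\sigma(\underline{\mathcal R}^{\mathcal J})$, $\overline{\mathcal G}^{\mathcal J}=\sigma(\overline{\mathcal R}^{\mathcal J})$. Conditioning on such a $\sigma$-algebra means conditioning on the events $\{\boldsymbol Z\in\mathcal S\}$ for $\mathcal S$ in it, i.e. on the pulled-back $\sigma$-algebra; in particular conditioning on $\underline{\mathcal G}^{\mathcal J}$ means conditioning on $\boldsymbol Z\in\mathcal S$ for any $\mathcal S\in\underline{\mathcal R}^{\mathcal J}$. Condition (b) is vacuous for $\mathcal J=\emptyset$. All conditioning sets $\mathcal S\in\mathcal R^{[K]}$ have positive probability under the law of $\boldsymbol Z$, so conditional probabilities given $\boldsymbol Z\in\mathcal S$ are elementary; statements conditional on $\boldsymbol W$ hold almost surely. *)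

theory Defs
  imports "HOL-Probability.Probability"
begin

(* Conditioning on an event E of positive probability as well is obtained by
   replacing M with uniform_measure M E. *)
definition cond_probability :: "'a measure \<Rightarrow> 'a measure \<Rightarrow> ('a \<Rightarrow> bool) \<Rightarrow> 'a \<Rightarrow> real" where
  "cond_probability M F Q = real_cond_exp M F (indicator {\<omega> \<in> space M. Q \<omega>})"

(* Mutual conditional independence given F of a finite family.  Taking B i = space (N i)
   for some indices yields the product rule for every subfamily. *)
definition cond_indep_vars ::
    "'a measure \<Rightarrow> 'a measure \<Rightarrow> ('i \<Rightarrow> 'b measure) \<Rightarrow> ('i \<Rightarrow> 'a \<Rightarrow> 'b) \<Rightarrow> 'i set \<Rightarrow> bool" where
  "cond_indep_vars M F N X I \<longleftrightarrow>
     (\<forall>B \<in> (\<Pi> i\<in>I. sets (N i)). AE \<omega> in M.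
        cond_probability M F (\<lambda>\<omega>. \<forall>i\<in>I. X i \<omega> \<in> B i) \<omega> =
        (\<Prod>i\<in>I. cond_probability M F (\<lambda>\<omega>. X i \<omega> \<in> B i) \<omega>))"

definition same_cond_distr ::
    "'a measure \<Rightarrow> 'a measure \<Rightarrow> 'b measure \<Rightarrow> ('a \<Rightarrow> 'b) \<Rightarrow> ('a \<Rightarrow> 'b) \<Rightarrow> bool" where
  "same_cond_distr M F N X Y \<longleftrightarrow>
     (\<forall>B \<in> sets N. AE \<omega> in M.
        cond_probability M F (\<lambda>\<omega>. X \<omega> \<in> B) \<omega> = cond_probability M F (\<lambda>\<omega>. Y \<omega> \<in> B) \<omega>)"

abbreviation sigma_of :: "'a measure \<Rightarrow> ('a \<Rightarrow> 'b) \<Rightarrow> 'b measure \<Rightarrow> 'a measure" where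
  "sigma_of M X N \<equiv> vimage_algebra (space M) X N"

(* For a sub-sigma-algebra G of the one on the range of X, sigma_of_pair M X G Y N is
   generated by the events {X \<in> S}, S in G, together with Y. *)
abbreviation sigma_of_pair ::
    "'a measure \<Rightarrow> ('a \<Rightarrow> 'b) \<Rightarrow> 'b measure \<Rightarrow> ('a \<Rightarrow> 'c) \<Rightarrow> 'c measure \<Rightarrow> 'a measure" where
  "sigma_of_pair M X G Y N \<equiv> vimage_algebra (space M) (\<lambda>\<omega>. (X \<omega>, Y \<omega>)) (G \<Otimes>\<^sub>M N)"

definition cond_indep_copy ::
    "'a measure \<Rightarrow> 'z measure \<Rightarrow> 'w measure \<Rightarrow> ('a \<Rightarrow> 'z) \<Rightarrow> ('a \<Rightarrow> 'w) \<Rightarrow> ('a \<Rightarrow> 'z) \<Rightarrow> bool" where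
  "cond_indep_copy M MZ MW Z W Zs \<longleftrightarrow>
     Zs \<in> measurable M MZ \<and>
     same_cond_distr M (sigma_of M W MW) MZ Zs Z \<and>
     cond_indep_vars M (sigma_of M W MW) (\<lambda>_. MZ) (case_bool Z Zs) UNIV"

definition cell :: "'z set set \<Rightarrow> 'z \<Rightarrow> 'z set" where
  "cell P z = (THE S. S \<in> P \<and> z \<in> S)"

definition union_family :: "('k \<Rightarrow> 'z set set) \<Rightarrow> 'k set \<Rightarrow> 'z set set" where
  "union_family R J = (\<Union>k\<in>J. R k)"

(* Only used for nonempty J. *)
definition refinement :: "'z set \<Rightarrow> ('k \<Rightarrow> 'z set set) \<Rightarrow> 'k set \<Rightarrow> 'z set set" where
  "refinement A R J = (\<lambda>z. \<Inter>j\<in>J. cell (R j) z) ` A"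

definition coarsening :: "'z set \<Rightarrow> ('k \<Rightarrow> 'z set set) \<Rightarrow> 'k set \<Rightarrow> 'z set set" where
  "coarsening A R J = (\<lambda>z. \<Union>j\<in>J. cell (R j) z) ` A"

(* The conditional probability, given the event {Zs \<in> cell P Z} and given (Z, W), of
   {t(Zs, W) \<le> t(Z, W)}; it is a version of a conditional expectation, so it is
   determined only up to null sets. *)
definition p_value ::
    "'a measure \<Rightarrow> 'z measure \<Rightarrow> 'w measure \<Rightarrow> ('a \<Rightarrow> 'z) \<Rightarrow> ('a \<Rightarrow> 'w) \<Rightarrow> ('a \<Rightarrow> 'z)
      \<Rightarrow> 'z set set \<Rightarrow> ('z \<Rightarrow> 'w \<Rightarrow> real) \<Rightarrow> 'a \<Rightarrow> real" where
  "p_value M MZ MW Z W Zs P t =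
     cond_probability (uniform_measure M {\<omega> \<in> space M. Zs \<omega> \<in> cell P (Z \<omega>)})
       (sigma_of_pair M Z MZ W MW)
       (\<lambda>\<omega>. t (Zs \<omega>) (W \<omega>) \<le> t (Z \<omega>) (W \<omega>))"

end

theory Submission
  imports Defs
begin

text \<open>Independence of \<open>Z\<close> and \<open>W\<close> reduces everything to a fixed value of \<open>W\<close>.  Condition (a) makes
  any two conditioning sets nested or disjoint, so they form a forest whose roots are the
  coarsest sets.  By induction from the leaves, on a conditioning set \<open>S\<close> the rejections of all
  strictly finer tests cost a factor \<open>\<alpha> k\<close> each, even jointly with any event about the statistics
  of the remaining tests: on a child \<open>T\<close> of \<open>S\<close>, condition (b) splits off the tests having \<open>T\<close> as a
  conditioning set, each of which rejects with conditional probability at most \<open>\<alpha> k\<close>.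
  At a root the same step gives the bound.\<close>

section \<open>Nested conditioning sets\<close>

text \<open>Test \<open>k\<close> compares its statistic with a threshold that depends on the cell
  of \<open>k\<close>. On a set \<open>S\<close> that \<open>k\<close> cuts into smaller cells, its
  rejection is therefore not an event about \<open>t k\<close> alone, and condition (b) on
  \<open>S\<close> does not speak of it. This forces the treatment set by set and a statement that
  carries arbitrary Borel events along. Condition (b) is used on \<open>S\<close> with the family
  \<open>above S\<close> of all tests having a block that contains \<open>S\<close>: the cells of
  these tests intersect exactly in \<open>S\<close>, so \<open>S\<close> belongs to their
  refinement. Passing to a fixed value of \<open>W\<close> meets two obstacles. The null sets in (b)
  vary with the Borel sets, of which there are uncountably many, and each p-value is only a version
  of a conditional expectation under a conditioned measure. Once both are removed, the bounds at
  fixed \<open>W\<close> are integrated over \<open>W\<close>, and the inequality on every event of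
  the conditioning sigma-algebra yields the almost sure bound.\<close>

lemma cell_eq:
  assumes "partition_on A P" "S \<in> P" "z \<in> S"
  shows "cell P z = S"
  unfolding cell_def
proof (rule the_equality)
  fix T assume T: "T \<in> P \<and> z \<in> T"
  show "T = S"
  proof (rule ccontr)
    assume "T \<noteq> S"
    then have "T \<inter> S = {}"
      using partition_onD2[OF assms(1)] T assms(2) by (auto simp: disjoint_def)
    then show False using T assms(3) by auto
  qed
qed (use assms in auto)

lemma
  assumes "partition_on A P" "z \<in> A"
  shows cell_in: "cell P z \<in> P" and mem_cell: "z \<in> cell P z"
proof -
  obtain S where S: "S \<in> P" "z \<in> S"
    using partition_onD1[OF assms(1)] assms(2) by blast
  then have "cell P z = S" using cell_eq[OF assms(1)] by blast
  then show "cell P z \<in> P" "z \<in> cell P z" using S by auto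
qed

text \<open>At a common point \<open>z\<close> the refinement contains \<open>S \<inter> T\<close>.
  By condition (a) this intersection is a block of one of the two partitions, and as it contains
  \<open>z\<close> it must be the block of \<open>z\<close> there, that is, \<open>S\<close> or
  \<open>T\<close>.\<close>

lemma refinement_subset_union_imp_nested:
  assumes part: "partition_on A (R j)" "partition_on A (R k)"
    and ref: "refinement A R {j, k} \<subseteq> union_family R {j, k}"
    and S: "S \<in> R j" and T: "T \<in> R k" and ne: "S \<inter> T \<noteq> {}"
  shows "S \<subseteq> T \<or> T \<subseteq> S"
proof -
  obtain z where z: "z \<in> S" "z \<in> T" using ne by blast
  have zA: "z \<in> A" using partition_onD1[OF part(1)] S z by blast
  have c: "cell (R j) z = S" "cell (R k) z = T"
    using cell_eq[OF part(1) S z(1)] cell_eq[OF part(2) T z(2)] by auto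
  have "S \<inter> T \<in> refinement A R {j, k}"
    unfolding refinement_def using zA c by (auto intro!: image_eqI[of _ _ z])
  then consider "S \<inter> T \<in> R j" | "S \<inter> T \<in> R k"
    using ref by (auto simp: union_family_def)
  then show ?thesis
  proof cases
    case 1
    have "S \<inter> T = S" using cell_eq[OF part(1) 1, of z] z c by auto
    then show ?thesis by auto
  next
    case 2
    have "S \<inter> T = T" using cell_eq[OF part(2) 2, of z] z c by auto
    then show ?thesis by auto
  qed
qed

section \<open>Super-uniformity of the p-value at a fixed outcome schedule\<close>

text \<open>Here \<open>\<mu>\<close> is the law of \<open>Z\<close> and \<open>f\<close> the
  statistic with \<open>W\<close> fixed. Unlike \<open>p_value\<close>, which is a version
  determined up to null sets, this ratio has a value at every point, so it can be studied for each
  \<open>W\<close> separately.\<close>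

definition rand_p_value :: "'z measure \<Rightarrow> 'z set set \<Rightarrow> ('z \<Rightarrow> real) \<Rightarrow> 'z \<Rightarrow> real" where
  "rand_p_value \<mu> P f z =
     measure \<mu> {x \<in> cell P z. f x \<le> f z} / measure \<mu> (cell P z)"

text \<open>This is validity of a single test on one block, multiplied out by the probability of the
  block. The values \<open>y\<close> with \<open>F y \<le> c\<close> form a down-closed set
  \<open>A\<close> because \<open>F\<close> is monotone. If a sequence in \<open>A\<close> increases
  cofinally, the event is an increasing union of level sets of probability at most \<open>c\<close>,
  and continuity from below applies; this also covers a jump of \<open>F\<close> at the supremum of
  \<open>A\<close>.\<close>

lemma (in prob_space) prob_cdf_le:
  fixes f :: "'a \<Rightarrow> real"
  assumes S: "S \<in> events" and f [measurable]: "f \<in> borel_measurable M"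
    and c: "0 \<le> c"
  shows "prob {z \<in> S. prob {x \<in> S. f x \<le> f z} \<le> c} \<le> c"
proof -
  define F where "F y = prob {x \<in> S. f x \<le> y}" for y
  define A where "A = {y. F y \<le> c}"
  have lev [measurable]: "{x \<in> S. f x \<le> y} \<in> events" for y
  proof -
    have "{x \<in> S. f x \<le> y} = S \<inter> {x \<in> space M. f x \<le> y}"
      using sets.sets_into_space[OF S] by auto
    then show ?thesis using S by simp
  qed
  have mono: "F x \<le> F y" if "x \<le> y" for x y
    unfolding F_def using that lev by (intro finite_measure_mono) auto
  have down: "x \<in> A" if "x \<le> y" "y \<in> A" for x y
    using mono[OF that(1)] that(2) by (auto simp: A_def)
  have eq: "{z \<in> S. prob {x \<in> S. f x \<le> f z} \<le> c} = {z \<in> S. f z \<in> A}"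
    by (auto simp: A_def F_def)
  \<comment> \<open>A cofinal sequence fails to exist only when \<open>A\<close> is empty. Otherwise
    it is \<open>n\<close> itself if \<open>A\<close> is unbounded, the constant
    \<open>Sup A\<close> if the supremum is attained, and \<open>Sup A - 1 / (n + 1)\<close> if it
    is not.\<close>
  show ?thesis
  proof (cases "\<exists>y. incseq y \<and> range y \<subseteq> A \<and> (\<forall>a\<in>A. \<exists>n. a \<le> y n)")
    case True
    then obtain y :: "nat \<Rightarrow> real"
      where y: "incseq y" "range y \<subseteq> A" "\<forall>a\<in>A. \<exists>n. a \<le> y n" by blast
    have "{z \<in> S. f z \<in> A} = (\<Union>n. {x \<in> S. f x \<le> y n})"
    proof (intro set_eqI iffI)
      fix z assume "z \<in> {z \<in> S. f z \<in> A}"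
      then show "z \<in> (\<Union>n. {x \<in> S. f x \<le> y n})" using y(3) by auto
    next
      fix z assume "z \<in> (\<Union>n. {x \<in> S. f x \<le> y n})"
      then obtain n where "z \<in> S" "f z \<le> y n" by auto
      then show "z \<in> {z \<in> S. f z \<in> A}" using y(2) down[of "f z" "y n"] by auto
    qed
    moreover have "(\<lambda>n. prob {x \<in> S. f x \<le> y n}) \<longlonglongrightarrow> prob (\<Union>n. {x \<in> S. f x \<le> y n})"
      using y(1) lev by (intro finite_Lim_measure_incseq)
        (auto simp: incseq_def intro: order_trans)
    moreover have "prob {x \<in> S. f x \<le> y n} \<le> c" for n
      using y(2) by (auto simp: A_def F_def)
    ultimately show ?thesis
      unfolding eq by (auto intro: LIMSEQ_le_const2)
  next
    case False
    have "A = {}"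
    proof (rule ccontr)
      assume ne: "A \<noteq> {}"
      have "\<exists>y. incseq y \<and> range y \<subseteq> A \<and> (\<forall>a\<in>A. \<exists>n. a \<le> y n)"
      proof (cases "bdd_above A")
        case False
        have "real n \<in> A" for n
          using False down unfolding bdd_above_def by (meson linear)
        then show ?thesis
          by (intro exI[of _ real]) (auto simp: incseq_def real_arch_simple)
      next
        case bdd: True
        show ?thesis
        proof (cases "Sup A \<in> A")
          case True
          then show ?thesis
            using bdd by (intro exI[of _ "\<lambda>_. Sup A"]) (auto intro: cSup_upper)
        next
          case False
          define y where "y n = Sup A - 1 / real (Suc n)" for n
          have "y n \<in> A" for n
          proof -
            have "y n < Sup A" by (simp add: y_def)
            then obtain a where "a \<in> A" "y n < a"
              using less_cSup_iff[OF ne bdd] by blast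
            then show ?thesis using down[of "y n" a] by simp
          qed
          moreover have "incseq y"
            unfolding incseq_def y_def by (auto intro!: divide_left_mono)
          moreover have "\<exists>n. a \<le> y n" if "a \<in> A" for a
          proof -
            have "a \<le> Sup A" "a \<noteq> Sup A"
              using that bdd False by (auto intro: cSup_upper)
            then have "0 < Sup A - a" by simp
            then obtain n where "inverse (real (Suc n)) < Sup A - a"
              using reals_Archimedean by blast
            then show ?thesis
              unfolding y_def by (intro exI[of _ n]) (simp add: inverse_eq_divide)
          qed
          ultimately show ?thesis by blast
        qed
      qed
      then show False using False by blast
    qed
    then show ?thesis unfolding eq using c by simp
  qed
qed

section \<open>The forest of conditioning sets at a fixed outcome schedule\<close>

text \<open>The situation left after fixing a value of \<open>W\<close>: the measure is the law of
  \<open>Z\<close>. The assumption \<open>nested\<close> is condition (a) together with disjointness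
  inside a single partition (the case \<open>j = k\<close>), and \<open>product_rule\<close> is
  condition (b) with elementary conditional probabilities. It is asked only for members of
  \<open>union_family R I\<close>, which are finitely many and have positive probability.\<close>

locale nested_tests = prob_space \<mu> for \<mu> :: "'z measure" +
  fixes I :: "'k set" and R :: "'k \<Rightarrow> 'z set set" and t :: "'k \<Rightarrow> 'z \<Rightarrow> real"
  assumes fin_I: "finite I"
    and fin_R: "\<And>k. k \<in> I \<Longrightarrow> finite (R k)"
    and part: "\<And>k. k \<in> I \<Longrightarrow> partition_on (space \<mu>) (R k)"
    and R_sets: "\<And>k. k \<in> I \<Longrightarrow> R k \<subseteq> sets \<mu>"
    and pos: "\<And>k S. k \<in> I \<Longrightarrow> S \<in> R k \<Longrightarrow> prob S > 0"
    and t_meas: "\<And>k. k \<in> I \<Longrightarrow> t k \<in> borel_measurable \<mu>"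
    and nested: "\<And>j k S T. \<lbrakk>j \<in> I; k \<in> I; S \<in> R j; T \<in> R k; S \<inter> T \<noteq> {}\<rbrakk> \<Longrightarrow> S \<subseteq> T \<or> T \<subseteq> S"
    and product_rule: "\<And>J S B. \<lbrakk>J \<subseteq> I; J \<noteq> {}; S \<in> refinement (space \<mu>) R J; S \<in> union_family R I;
        \<And>k. k \<in> J \<Longrightarrow> B k \<in> sets borel\<rbrakk> \<Longrightarrow>
        prob {z \<in> S. \<forall>k\<in>J. t k z \<in> B k} / prob S = (\<Prod>k\<in>J. prob {z \<in> S. t k z \<in> B k} / prob S)"
begin

abbreviation "U \<equiv> union_family R I"

text \<open>For a conditioning set \<open>S\<close>, nestedness makes this a dichotomy: a test
  either has one block containing all of \<open>S\<close>, or every block of it that meets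
  \<open>S\<close> lies strictly inside \<open>S\<close>.\<close>

definition above :: "'z set \<Rightarrow> 'k set" where
  "above S = {k \<in> I. \<exists>C\<in>R k. S \<subseteq> C}"

definition own :: "'z set \<Rightarrow> 'k set" where
  "own S = {k \<in> I. S \<in> R k}"

definition rejects :: "('k \<Rightarrow> real) \<Rightarrow> 'k \<Rightarrow> 'z \<Rightarrow> bool" where
  "rejects \<alpha> k z \<longleftrightarrow> rand_p_value \<mu> (R k) (t k) z \<le> \<alpha> k"

lemma U_E:
  assumes "S \<in> U"
  obtains k where "k \<in> I" "S \<in> R k"
  using assms by (auto simp: union_family_def)

lemma finite_U: "finite U"
  using fin_I fin_R by (auto simp: union_family_def)

lemma U_sets: "S \<in> U \<Longrightarrow> S \<in> events"
  using R_sets by (auto simp: union_family_def)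

lemma U_ne: "S \<in> U \<Longrightarrow> S \<noteq> {}"
  using partition_onD3[OF part] by (auto simp: union_family_def)

lemma U_pos: "S \<in> U \<Longrightarrow> prob S > 0"
  using pos by (auto simp: union_family_def)

lemma U_nested: "S \<in> U \<Longrightarrow> T \<in> U \<Longrightarrow> S \<inter> T \<noteq> {} \<Longrightarrow> S \<subseteq> T \<or> T \<subseteq> S"
  using nested unfolding union_family_def by blast

lemma above_subset: "above S \<subseteq> I"
  by (auto simp: above_def)

lemma cell_above:
  assumes "k \<in> above S" "z \<in> S"
  shows "S \<subseteq> cell (R k) z"
proof -
  obtain C where "k \<in> I" "C \<in> R k" "S \<subseteq> C" using assms(1) by (auto simp: above_def)
  then show ?thesis using cell_eq[OF part, of k C z] assms(2) by auto
qed

text \<open>At a point of \<open>S\<close> every cell of a test in \<open>above S\<close> contains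
  \<open>S\<close>, and some test has \<open>S\<close> itself as its cell, so the intersection of
  these cells is \<open>S\<close>. This makes \<open>product_rule\<close> applicable on
  \<open>S\<close> with \<open>J = above S\<close>.\<close>

lemma in_refinement_above:
  assumes S: "S \<in> U"
  shows "S \<in> refinement (space \<mu>) R (above S)" and "above S \<noteq> {}"
proof -
  obtain k where k: "k \<in> I" "S \<in> R k" using U_E[OF S] .
  then have ka: "k \<in> above S" by (auto simp: above_def)
  then show "above S \<noteq> {}" by auto
  obtain z where z: "z \<in> S" using U_ne[OF S] by auto
  have "(\<Inter>j\<in>above S. cell (R j) z) = S"
    using cell_above[OF _ z] cell_eq[OF part[OF k(1)] k(2) z] ka by blast
  then show "S \<in> refinement (space \<mu>) R (above S)"
    unfolding refinement_def using z sets.sets_into_space[OF U_sets[OF S]]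
    by (auto intro!: image_eqI[of _ _ z])
qed

section \<open>Rejections as Borel events of the statistics\<close>

text \<open>On a block of its own partition the threshold of the test is constant, so the rejection
  becomes membership of the statistic in a fixed set of reals, which is the form that
  \<open>product_rule\<close> accepts.\<close>

lemma rejects_on_cell:
  assumes "k \<in> I" "S \<in> R k" "z \<in> S"
  shows "rejects \<alpha> k z \<longleftrightarrow> t k z \<in> {y. prob {x \<in> S. t k x \<le> y} \<le> \<alpha> k * prob S}"
  using cell_eq[OF part[OF assms(1)] assms(2,3)] pos[OF assms(1,2)]
  by (simp add: rejects_def rand_p_value_def divide_le_eq)

lemma level_set:
  assumes k: "k \<in> I" and S: "S \<in> events"
  shows "{z \<in> S. t k z \<le> y} \<in> events"
proof -
  have "{z \<in> S. t k z \<le> y} = S \<inter> {z \<in> space \<mu>. t k z \<le> y}"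
    using sets.sets_into_space[OF S] by auto
  then show ?thesis using S t_meas[OF k] by simp
qed

lemma rejection_set_borel:
  assumes k: "k \<in> I" and S: "S \<in> events"
  shows "{y. prob {x \<in> S. t k x \<le> y} \<le> c} \<in> sets borel"
proof -
  have "mono (\<lambda>y. prob {x \<in> S. t k x \<le> y})"
    using level_set[OF k S] by (intro monoI finite_measure_mono) auto
  then have "(\<lambda>y. prob {x \<in> S. t k x \<le> y}) \<in> borel_measurable borel"
    by (rule borel_measurable_mono)
  then show ?thesis by measurable
qed

lemma stat_set:
  assumes "k \<in> I" "B \<in> sets borel"
  shows "{z \<in> space \<mu>. t k z \<in> B} \<in> events"
  using assms t_meas by measurable

lemma rejects_set:
  assumes k: "k \<in> I"
  shows "{z \<in> space \<mu>. rejects \<alpha> k z} \<in> events"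
proof -
  have "{z \<in> space \<mu>. rejects \<alpha> k z} =
      (\<Union>S\<in>R k. S \<inter> {z \<in> space \<mu>. t k z \<in> {y. prob {x \<in> S. t k x \<le> y} \<le> \<alpha> k * prob S}})"
  proof (intro set_eqI iffI)
    fix z assume z: "z \<in> {z \<in> space \<mu>. rejects \<alpha> k z}"
    then obtain S where "S \<in> R k" "z \<in> S" using partition_onD1[OF part[OF k]] by auto
    then show "z \<in> (\<Union>S\<in>R k. S \<inter> {z \<in> space \<mu>. t k z \<in>
        {y. prob {x \<in> S. t k x \<le> y} \<le> \<alpha> k * prob S}})"
      using rejects_on_cell[OF k, of S z \<alpha>] z by auto
  next
    fix z assume "z \<in> (\<Union>S\<in>R k. S \<inter> {z \<in> space \<mu>. t k z \<in>
        {y. prob {x \<in> S. t k x \<le> y} \<le> \<alpha> k * prob S}})"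
    then obtain S where "S \<in> R k" "z \<in> S" "z \<in> space \<mu>"
      "t k z \<in> {y. prob {x \<in> S. t k x \<le> y} \<le> \<alpha> k * prob S}" by blast
    then show "z \<in> {z \<in> space \<mu>. rejects \<alpha> k z}"
      using rejects_on_cell[OF k, of S z \<alpha>] by blast
  qed
  also have "\<dots> \<in> events"
    using R_sets[OF k]
    by (intro sets.finite_UN fin_R[OF k] sets.Int stat_set[OF k] rejection_set_borel[OF k]) auto
  finally show ?thesis .
qed

lemma joint_event:
  assumes S: "S \<in> events" and H: "H \<subseteq> I" and C: "\<And>k. k \<in> H \<Longrightarrow> C k \<in> sets borel" and J: "J \<subseteq> I"
  shows "{z \<in> S. (\<forall>k\<in>H. t k z \<in> C k) \<and> (\<forall>k\<in>J. rejects \<alpha> k z)} \<in> events"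
proof -
  have "{z \<in> S. (\<forall>k\<in>H. t k z \<in> C k) \<and> (\<forall>k\<in>J. rejects \<alpha> k z)} =
     S \<inter> {z \<in> space \<mu>. (\<forall>k\<in>H. t k z \<in> C k) \<and> (\<forall>k\<in>J. rejects \<alpha> k z)}"
    using sets.sets_into_space[OF S] by auto
  also have "\<dots> \<in> events"
    using S stat_set C rejects_set H J finite_subset[OF H fin_I] finite_subset[OF J fin_I]
    by (intro sets.Int sets.sets_Collect_conj sets.sets_Collect_finite_All) auto
  finally show ?thesis .
qed

section \<open>Children of a conditioning set and the induction\<close>

definition children :: "'z set \<Rightarrow> 'z set set" where
  "children S = {T \<in> U. T \<subset> S \<and> (\<forall>T'\<in>U. T' \<subset> S \<longrightarrow> T \<subseteq> T' \<longrightarrow> T' = T)}"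

lemma children_disjoint:
  assumes "T \<in> children S" "T' \<in> children S" "T \<noteq> T'"
  shows "T \<inter> T' = {}"
proof (rule ccontr)
  assume "T \<inter> T' \<noteq> {}"
  then have "T \<subseteq> T' \<or> T' \<subseteq> T" using U_nested assms by (auto simp: children_def)
  then show False using assms by (auto simp: children_def)
qed

text \<open>The cell of \<open>k\<close> at any point of \<open>S\<close> lies strictly inside
  \<open>S\<close>, so some child contains that point. The assumption on \<open>k\<close> excludes
  the leaves: if every test belongs to \<open>above S\<close>, then no conditioning set lies
  strictly inside \<open>S\<close>.\<close>

lemma children_cover:
  assumes S: "S \<in> U" and k: "k \<in> I - above S"
  shows "S = \<Union>(children S)"
proof
  show "\<Union>(children S) \<subseteq> S" by (auto simp: children_def)
  show "S \<subseteq> \<Union>(children S)"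
  proof
    fix z assume z: "z \<in> S"
    have zs: "z \<in> space \<mu>" using z sets.sets_into_space[OF U_sets[OF S]] by auto
    let ?C = "cell (R k) z"
    have C: "?C \<in> R k" "z \<in> ?C" using cell_in[OF part zs] mem_cell[OF part zs] k by auto
    then have CU: "?C \<in> U" using k by (auto simp: union_family_def)
    have "?C \<inter> S \<noteq> {}" using C z by auto
    then have "?C \<subset> S" using U_nested[OF CU S] k C by (auto simp: above_def)
    \<comment> \<open>Restricting to sets through \<open>z\<close> loses nothing: a superset of a
      member of \<open>V\<close> still contains \<open>z\<close>, so a maximal member of
      \<open>V\<close> is maximal among all conditioning sets strictly inside
      \<open>S\<close>.\<close>
    define V where "V = {T \<in> U. T \<subset> S \<and> z \<in> T}"
    have "finite V" "?C \<in> V"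
      using finite_U CU C \<open>?C \<subset> S\<close> by (auto simp: V_def)
    then obtain T where T: "T \<in> V" "\<forall>T'\<in>V. T \<subseteq> T' \<longrightarrow> T = T'"
      using finite_has_maximal2[of V ?C] by blast
    have "T' = T" if "T' \<in> U" "T' \<subset> S" "T \<subseteq> T'" for T'
      using T that unfolding V_def by blast
    then have "T \<in> children S" using T(1) unfolding children_def V_def by blast
    then show "z \<in> \<Union>(children S)" using T(1) unfolding V_def by blast
  qed
qed

text \<open>If a test has a block \<open>C\<close> containing \<open>T\<close> but none containing
  \<open>S\<close>, then nestedness puts \<open>C\<close> strictly inside \<open>S\<close>, and
  maximality of the child \<open>T\<close> gives \<open>C = T\<close>. Hence every test that joins
  on passing from \<open>S\<close> to \<open>T\<close> has exactly \<open>T\<close> as a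
  block.\<close>

lemma above_child:
  assumes S: "S \<in> U" and T: "T \<in> children S"
  shows "above S \<subseteq> above T" and "above T - above S \<subseteq> own T"
proof -
  have "T \<subseteq> S" using T by (auto simp: children_def)
  then show "above S \<subseteq> above T" unfolding above_def by (auto intro: order_trans)
  show "above T - above S \<subseteq> own T"
  proof
    fix k assume k: "k \<in> above T - above S"
    then obtain C where C: "k \<in> I" "C \<in> R k" "T \<subseteq> C" by (auto simp: above_def)
    have CU: "C \<in> U" using C by (auto simp: union_family_def)
    have "C \<inter> S \<noteq> {}" using T C U_ne[of T] by (auto simp: children_def)
    then have "C \<subset> S" using U_nested[OF CU S] k C by (auto simp: above_def)
    then have "C = T" using T C CU by (auto simp: children_def)
    then show "k \<in> own T" using C by (auto simp: own_def)
  qed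
qed

text \<open>The tests in \<open>own T\<close> reject on \<open>T\<close> according to the values of their statistics, so
  the product rule on \<open>T\<close> splits them off; the finer ones have been handled inside \<open>T\<close>.\<close>

lemma split_own:
  assumes T: "T \<in> U" and H: "H \<subseteq> above T" "above T - H \<subseteq> own T"
    and \<alpha>: "\<And>k. k \<in> I \<Longrightarrow> 0 \<le> \<alpha> k"
    and C: "\<And>k. k \<in> H \<Longrightarrow> C k \<in> sets borel"
    and fine: "\<And>C'. (\<And>k. k \<in> above T \<Longrightarrow> C' k \<in> sets borel) \<Longrightarrow>
      prob {z \<in> T. (\<forall>k\<in>above T. t k z \<in> C' k) \<and> (\<forall>k\<in>I - above T. rejects \<alpha> k z)}
      \<le> prob {z \<in> T. \<forall>k\<in>above T. t k z \<in> C' k} * (\<Prod>k\<in>I - above T. \<alpha> k)"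
  shows "prob {z \<in> T. (\<forall>k\<in>H. t k z \<in> C k) \<and> (\<forall>k\<in>I - H. rejects \<alpha> k z)}
      \<le> prob {z \<in> T. \<forall>k\<in>H. t k z \<in> C k} * (\<Prod>k\<in>I - H. \<alpha> k)"
proof -
  \<comment> \<open>\<open>H\<close> will be \<open>above S\<close> for the parent \<open>S\<close>
    of \<open>T\<close>, or empty when \<open>T\<close> is a coarsest set. For the tests to be split
    off, \<open>C1\<close> inserts the rejection region on \<open>T\<close> and \<open>C2\<close>
    imposes nothing.\<close>
  define C1 where "C1 k = (if k \<in> H then C k
      else {y. prob {x \<in> T. t k x \<le> y} \<le> \<alpha> k * prob T})" for k
  define C2 where "C2 k = (if k \<in> H then C k else UNIV)" for k
  have new: "k \<in> I" "T \<in> R k" if "k \<in> above T - H" for k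
    using that H(2) by (auto simp: own_def)
  have finA: "finite (above T)" using finite_subset[OF above_subset fin_I] .
  have p: "prob T > 0" using U_pos[OF T] .
  have C1: "C1 k \<in> sets borel" and C2: "C2 k \<in> sets borel" if "k \<in> above T" for k
    using that C rejection_set_borel[OF subsetD[OF above_subset that] U_sets[OF T]]
    by (auto simp: C1_def C2_def)
  \<comment> \<open>The rule is used twice: with \<open>C1\<close> to factor the rejections out, and
    with \<open>C2\<close> in the reverse direction to reassemble the factors over \<open>H\<close>
    into one joint probability.\<close>
  have rule: "prob {z \<in> T. \<forall>k\<in>above T. t k z \<in> B k} / prob T =
      (\<Prod>k\<in>H. prob {z \<in> T. t k z \<in> B k} / prob T) *
      (\<Prod>k\<in>above T - H. prob {z \<in> T. t k z \<in> B k} / prob T)"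
    if "\<And>k. k \<in> above T \<Longrightarrow> B k \<in> sets borel" for B
    using product_rule[OF above_subset in_refinement_above(2,1)[OF T] T that]
      prod.subset_diff[OF H(1) finA] by (simp add: mult.commute)
  have rule1: "prob {z \<in> T. \<forall>k\<in>above T. t k z \<in> C1 k} / prob T =
      (\<Prod>k\<in>H. prob {z \<in> T. t k z \<in> C1 k} / prob T) *
      (\<Prod>k\<in>above T - H. prob {z \<in> T. t k z \<in> C1 k} / prob T)"
    by (rule rule[of C1]) (rule C1)
  have rule2: "prob {z \<in> T. \<forall>k\<in>above T. t k z \<in> C2 k} / prob T =
      (\<Prod>k\<in>H. prob {z \<in> T. t k z \<in> C2 k} / prob T) *
      (\<Prod>k\<in>above T - H. prob {z \<in> T. t k z \<in> C2 k} / prob T)"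
    by (rule rule[of C2]) (rule C2)
  \<comment> \<open>The constant in \<open>prob_cdf_le\<close> is
    \<open>\<alpha> k * prob T\<close>, so that division by \<open>prob T\<close> leaves the level
    of the test.\<close>
  have one: "prob {z \<in> T. t k z \<in> C1 k} / prob T \<le> \<alpha> k" if k: "k \<in> above T - H" for k
  proof -
    have "prob {z \<in> T. t k z \<in> C1 k} \<le> \<alpha> k * prob T"
      using prob_cdf_le[OF U_sets[OF T] t_meas[OF new(1)[OF k]], of "\<alpha> k * prob T"]
        \<alpha>[OF new(1)[OF k]] p k by (auto simp: C1_def)
    then show ?thesis using p by (simp add: divide_le_eq)
  qed
  have "prob {z \<in> T. \<forall>k\<in>above T. t k z \<in> C1 k} / prob T
      \<le> (\<Prod>k\<in>H. prob {z \<in> T. t k z \<in> C k} / prob T) * (\<Prod>k\<in>above T - H. \<alpha> k)"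
    unfolding rule1
  proof (rule mult_mono)
    show "(\<Prod>k\<in>H. prob {z \<in> T. t k z \<in> C1 k} / prob T)
        \<le> (\<Prod>k\<in>H. prob {z \<in> T. t k z \<in> C k} / prob T)"
      by (simp add: C1_def)
    show "(\<Prod>k\<in>above T - H. prob {z \<in> T. t k z \<in> C1 k} / prob T) \<le> (\<Prod>k\<in>above T - H. \<alpha> k)"
      using one p by (intro prod_mono) auto
  qed (use p in \<open>auto intro!: prod_nonneg\<close>)
  \<comment> \<open>Under \<open>C2\<close> the factors outside \<open>H\<close> all equal 1, so the
    product over \<open>H\<close> is a joint probability again.\<close>
  also have "(\<Prod>k\<in>H. prob {z \<in> T. t k z \<in> C k} / prob T) =
      prob {z \<in> T. \<forall>k\<in>above T. t k z \<in> C2 k} / prob T"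
    unfolding rule2 using p by (simp add: C2_def)
  also have "{z \<in> T. \<forall>k\<in>above T. t k z \<in> C2 k} = {z \<in> T. \<forall>k\<in>H. t k z \<in> C k}"
    using H(1) by (auto simp: C2_def)
  finally have mid: "prob {z \<in> T. \<forall>k\<in>above T. t k z \<in> C1 k}
      \<le> prob {z \<in> T. \<forall>k\<in>H. t k z \<in> C k} * (\<Prod>k\<in>above T - H. \<alpha> k)"
    using p by (simp add: field_simps)
  have "{z \<in> T. (\<forall>k\<in>H. t k z \<in> C k) \<and> (\<forall>k\<in>I - H. rejects \<alpha> k z)} =
      {z \<in> T. (\<forall>k\<in>above T. t k z \<in> C1 k) \<and> (\<forall>k\<in>I - above T. rejects \<alpha> k z)}"
  proof (rule Collect_cong, rule conj_cong[OF refl])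
    fix z assume z: "z \<in> T"
    have "rejects \<alpha> k z \<longleftrightarrow> t k z \<in> C1 k" if "k \<in> above T - H" for k
      using rejects_on_cell[OF new[OF that] z] that by (simp add: C1_def)
    moreover have "I - H = (above T - H) \<union> (I - above T)" "above T = H \<union> (above T - H)"
      using H(1) above_subset by auto
    ultimately show "((\<forall>k\<in>H. t k z \<in> C k) \<and> (\<forall>k\<in>I - H. rejects \<alpha> k z)) \<longleftrightarrow>
      ((\<forall>k\<in>above T. t k z \<in> C1 k) \<and> (\<forall>k\<in>I - above T. rejects \<alpha> k z))"
      by (smt (verit) C1_def Diff_iff Un_iff)
  qed
  \<comment> \<open>Here the freedom of the Borel sets in \<open>fine\<close> pays off: they are
    chosen as \<open>C1\<close>, which contains the rejection regions of the tests being split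
    off.\<close>
  also have "prob \<dots> \<le> prob {z \<in> T. \<forall>k\<in>above T. t k z \<in> C1 k} * (\<Prod>k\<in>I - above T. \<alpha> k)"
    by (rule fine) (rule C1)
  also have "\<dots> \<le> prob {z \<in> T. \<forall>k\<in>H. t k z \<in> C k} * (\<Prod>k\<in>above T - H. \<alpha> k) * (\<Prod>k\<in>I - above T. \<alpha> k)"
    using mid \<alpha> by (intro mult_right_mono prod_nonneg) auto
  also have "\<dots> = prob {z \<in> T. \<forall>k\<in>H. t k z \<in> C k} * (\<Prod>k\<in>I - H. \<alpha> k)"
  proof -
    have "I - H - (I - above T) = above T - H" using above_subset by blast
    moreover have "I - above T \<subseteq> I - H" using H(1) by blast
    ultimately show ?thesis
      using prod.subset_diff[of "I - above T" "I - H" \<alpha>] fin_I by simp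
  qed
  finally show ?thesis .
qed

text \<open>The induction is on the number of conditioning sets strictly inside \<open>S\<close>.
  The children partition \<open>S\<close>, and \<open>split_own\<close> with
  \<open>H = above S\<close> gives on every child the same factor
  \<open>\<Prod>k\<in>I - above S. \<alpha> k\<close>, whatever tests own that child; so the bounds
  on the children add up to the bound on \<open>S\<close>. At a leaf the product is empty.\<close>

lemma fine_bound:
  assumes S: "S \<in> U" and \<alpha>: "\<And>k. k \<in> I \<Longrightarrow> 0 \<le> \<alpha> k"
    and C: "\<And>k. k \<in> above S \<Longrightarrow> C k \<in> sets borel"
  shows "prob {z \<in> S. (\<forall>k\<in>above S. t k z \<in> C k) \<and> (\<forall>k\<in>I - above S. rejects \<alpha> k z)}
      \<le> prob {z \<in> S. \<forall>k\<in>above S. t k z \<in> C k} * (\<Prod>k\<in>I - above S. \<alpha> k)"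
  using S C
proof (induction "card {T \<in> U. T \<subset> S}" arbitrary: S C rule: less_induct)
  case less
  show ?case
  proof (cases "I - above S = {}")
    case True
    then show ?thesis unfolding True by simp
  next
    case False
    then obtain k where "k \<in> I - above S" by blast
    note cover = children_cover[OF less.prems(1) this]
    let ?E = "\<lambda>T. {z \<in> T. (\<forall>k\<in>above S. t k z \<in> C k) \<and> (\<forall>k\<in>I - above S. rejects \<alpha> k z)}"
    let ?D = "\<lambda>T. {z \<in> T. \<forall>k\<in>above S. t k z \<in> C k}"
    have chU: "T \<in> U" if "T \<in> children S" for T using that by (auto simp: children_def)
    have fin: "finite (children S)" using finite_U by (auto simp: children_def)
    have E: "?E T \<in> events" and D: "?D T \<in> events" if "T \<in> children S" for T
      using joint_event[OF U_sets[OF chU[OF that]] above_subset, of S C "I - above S" \<alpha>]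
        joint_event[OF U_sets[OF chU[OF that]] above_subset, of S C "{}" \<alpha>] less.prems by auto
    have step: "prob (?E T) \<le> prob (?D T) * (\<Prod>k\<in>I - above S. \<alpha> k)" if T: "T \<in> children S" for T
    proof (rule split_own[OF chU[OF T] above_child[OF less.prems(1) T] \<alpha> less.prems(2)])
      fix C' :: "'k \<Rightarrow> real set"
      assume C': "\<And>k. k \<in> above T \<Longrightarrow> C' k \<in> sets borel"
      \<comment> \<open>The inclusion is strict because \<open>T\<close> itself is counted on the
        right only.\<close>
      have "card {T' \<in> U. T' \<subset> T} < card {T \<in> U. T \<subset> S}"
        using T finite_U by (intro psubset_card_mono) (auto simp: children_def)
      from less.hyps[OF this chU[OF T] C']
      show "prob {z \<in> T. (\<forall>k\<in>above T. t k z \<in> C' k) \<and> (\<forall>k\<in>I - above T. rejects \<alpha> k z)}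
        \<le> prob {z \<in> T. \<forall>k\<in>above T. t k z \<in> C' k} * (\<Prod>k\<in>I - above T. \<alpha> k)"
        by auto
    qed
    have "?E S = (\<Union>T\<in>children S. ?E T)" "?D S = (\<Union>T\<in>children S. ?D T)"
      using cover by blast+
    moreover have "prob (\<Union>T\<in>children S. ?E T) = (\<Sum>T\<in>children S. prob (?E T))"
      using children_disjoint E fin
      by (intro finite_measure_finite_Union) (auto simp: disjoint_family_on_def)
    moreover have "prob (\<Union>T\<in>children S. ?D T) = (\<Sum>T\<in>children S. prob (?D T))"
      using children_disjoint D fin
      by (intro finite_measure_finite_Union) (auto simp: disjoint_family_on_def)
    ultimately show ?thesis
      using sum_mono[OF step, of "children S" "\<lambda>x. x"] by (simp add: sum_distrib_right)
  qed
qed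

section \<open>Coarsest sets and the sigma-algebra they generate\<close>

text \<open>All cells at \<open>z\<close> share the point \<open>z\<close>, so they form a chain and
  their union is the largest of them, a conditioning set. A test having a block around
  \<open>S\<close> has its cell at \<open>z\<close> both above \<open>S\<close> and inside the union
  \<open>S\<close>, so that cell is \<open>S\<close>.\<close>

lemma coarse_cell:
  assumes ne: "I \<noteq> {}" and S: "S \<in> coarsening (space \<mu>) R I"
  shows "S \<in> U" "above S \<subseteq> own S"
proof -
  obtain z where z: "z \<in> space \<mu>" "S = (\<Union>j\<in>I. cell (R j) z)"
    using S by (auto simp: coarsening_def)
  let ?F = "(\<lambda>j. cell (R j) z) ` I"
  have cU: "?F \<subseteq> U" using cell_in[OF part z(1)] by (auto simp: union_family_def)
  have zc: "z \<in> T" if "T \<in> ?F" for T using that mem_cell[OF part z(1)] by auto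
  obtain T where T: "T \<in> ?F" "\<forall>T'\<in>?F. T \<subseteq> T' \<longrightarrow> T' = T"
    using finite_has_maximal[of ?F] ne fin_I by auto
  have "T' \<subseteq> T" if "T' \<in> ?F" for T'
    using U_nested[of T T'] cU T that zc by blast
  then have ST: "S = T" using T(1) z(2) by blast
  then show SU: "S \<in> U" using T cU by auto
  show "above S \<subseteq> own S"
  proof
    fix k assume k: "k \<in> above S"
    then have kI: "k \<in> I" by (auto simp: above_def)
    have "S \<subseteq> cell (R k) z" using cell_above[OF k] zc T ST by auto
    then have "S = cell (R k) z" using z(2) kI by blast
    then show "k \<in> own S" using cell_in[OF part z(1)] kI by (auto simp: own_def)
  qed
qed

text \<open>On a coarsest set every test in \<open>above S\<close> is owned by \<open>S\<close>, so
  \<open>split_own\<close> may be used with \<open>H\<close> empty, and no event about the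
  statistics remains.\<close>

lemma coarse_bound:
  assumes ne: "I \<noteq> {}" and S: "S \<in> coarsening (space \<mu>) R I" and \<alpha>: "\<And>k. k \<in> I \<Longrightarrow> 0 \<le> \<alpha> k"
  shows "prob {z \<in> S. \<forall>k\<in>I. rejects \<alpha> k z} \<le> prob S * (\<Prod>k\<in>I. \<alpha> k)"
proof -
  note c = coarse_cell[OF ne S]
  have "prob {z \<in> S. (\<forall>k\<in>{}. t k z \<in> UNIV) \<and> (\<forall>k\<in>I - {}. rejects \<alpha> k z)}
      \<le> prob {z \<in> S. \<forall>k\<in>{}. t k z \<in> UNIV} * (\<Prod>k\<in>I - {}. \<alpha> k)"
    by (rule split_own[OF c(1) _ _ \<alpha> _ fine_bound[OF c(1) \<alpha>]]) (use c(2) in auto)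
  then show ?thesis by simp
qed

text \<open>Two meeting coarsest sets are nested. The test owning the larger one lies in
  \<open>above\<close> of the smaller one and hence owns it too; then both are blocks of one
  partition sharing a point.\<close>

lemma coarsening_partition:
  assumes ne: "I \<noteq> {}"
  shows "partition_on (space \<mu>) (coarsening (space \<mu>) R I)"
proof (rule partition_onI)
  have "S \<subseteq> space \<mu>" if "S \<in> coarsening (space \<mu>) R I" for S
    using sets.sets_into_space[OF U_sets[OF coarse_cell(1)[OF ne that]]] .
  moreover obtain k where k: "k \<in> I" using ne by blast
  then have "z \<in> (\<Union>j\<in>I. cell (R j) z)" if "z \<in> space \<mu>" for z
    using mem_cell[OF part[OF k] that] by blast
  then have "space \<mu> \<subseteq> \<Union>(coarsening (space \<mu>) R I)"
    unfolding coarsening_def by blast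
  ultimately show "\<Union>(coarsening (space \<mu>) R I) = space \<mu>" by blast
  show "disjnt S T" if S: "S \<in> coarsening (space \<mu>) R I" and T: "T \<in> coarsening (space \<mu>) R I"
    and "S \<noteq> T" for S T
  proof (rule ccontr)
    assume "\<not> disjnt S T"
    then obtain z where z: "z \<in> S" "z \<in> T" by (auto simp: disjnt_def)
    obtain j where "j \<in> I" "S \<in> R j" using U_E[OF coarse_cell(1)[OF ne S]] .
    obtain k where "k \<in> I" "T \<in> R k" using U_E[OF coarse_cell(1)[OF ne T]] .
    have "S \<subseteq> T \<or> T \<subseteq> S"
      using U_nested[OF coarse_cell(1)[OF ne S] coarse_cell(1)[OF ne T]] z by auto
    then have "j \<in> above T \<or> k \<in> above S"
      using \<open>j \<in> I\<close> \<open>S \<in> R j\<close> \<open>k \<in> I\<close> \<open>T \<in> R k\<close> by (auto simp: above_def)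
    then have "T \<in> R j \<or> S \<in> R k"
      using coarse_cell(2)[OF ne S] coarse_cell(2)[OF ne T] by (auto simp: own_def)
    then show False
      using cell_eq[OF part] z \<open>j \<in> I\<close> \<open>S \<in> R j\<close> \<open>k \<in> I\<close> \<open>T \<in> R k\<close> \<open>S \<noteq> T\<close> by metis
  qed
  show "{} \<notin> coarsening (space \<mu>) R I"
    using coarse_cell(1)[OF ne] U_ne by blast
qed

lemma finite_coarsening: "I \<noteq> {} \<Longrightarrow> finite (coarsening (space \<mu>) R I)"
  using finite_subset[OF _ finite_U] coarse_cell(1) by blast

end

text \<open>The property that every block is either inside a set or disjoint from it holds for the
  blocks and survives complements and countable unions.\<close>

lemma sigma_partition:
  assumes P: "partition_on A P" and D: "D \<in> sigma_sets A P"
  shows "D = \<Union>{S \<in> P. S \<subseteq> D}"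
proof -
  have *: "S \<subseteq> D \<or> S \<inter> D = {}" if S: "S \<in> P" for S
    using D
  proof induction
    case (Basic T)
    then show ?case using partition_onD2[OF P] S by (auto simp: disjoint_def)
  next
    case (Compl T)
    then show ?case using partition_onD1[OF P] S by blast
  next
    case (Union T)
    then show ?case by blast
  qed simp
  have "D \<subseteq> A" using sigma_sets_into_sp[OF _ D] partition_onD1[OF P] by blast
  then show ?thesis using * partition_onD1[OF P] by blast
qed

text \<open>\<open>D\<close> is a finite disjoint union of coarsest sets, and both sides are
  additive. Having all such \<open>D\<close> prepares the bound on a conditional probability given
  the generated sigma-algebra.\<close>

lemma (in nested_tests) coarse_sigma_bound:
  assumes ne: "I \<noteq> {}" and D: "D \<in> sigma_sets (space \<mu>) (coarsening (space \<mu>) R I)"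
    and \<alpha>: "\<And>k. k \<in> I \<Longrightarrow> 0 \<le> \<alpha> k"
  shows "prob {z \<in> D. \<forall>k\<in>I. rejects \<alpha> k z} \<le> prob D * (\<Prod>k\<in>I. \<alpha> k)"
proof -
  define Q where "Q = {S \<in> coarsening (space \<mu>) R I. S \<subseteq> D}"
  note P = coarsening_partition[OF ne]
  have DQ: "D = \<Union>Q" unfolding Q_def using sigma_partition[OF P D] .
  let ?E = "\<lambda>S. {z \<in> S. \<forall>k\<in>I. rejects \<alpha> k z}"
  have fin: "finite Q" using finite_coarsening[OF ne] by (auto simp: Q_def)
  have Qs: "S \<in> events" if "S \<in> Q" for S
    using that U_sets coarse_cell(1)[OF ne] by (auto simp: Q_def)
  have E: "?E S \<in> events" if "S \<in> Q" for S
    using joint_event[OF Qs[OF that], of "{}" undefined I \<alpha>] by simp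
  have dis: "S \<inter> T = {}" if "S \<in> Q" "T \<in> Q" "S \<noteq> T" for S T
    using that partition_onD2[OF P] by (auto simp: Q_def disjoint_def)
  have "?E D = (\<Union>S\<in>Q. ?E S)" using DQ by auto
  also have "prob \<dots> = (\<Sum>S\<in>Q. prob (?E S))"
    using dis E fin by (intro finite_measure_finite_Union) (auto simp: disjoint_family_on_def)
  also have "\<dots> \<le> (\<Sum>S\<in>Q. prob S * (\<Prod>k\<in>I. \<alpha> k))"
    using coarse_bound[OF ne _ \<alpha>] by (intro sum_mono) (auto simp: Q_def)
  also have "\<dots> = prob (\<Union>S\<in>Q. S) * (\<Prod>k\<in>I. \<alpha> k)"
    using dis Qs fin by (subst finite_measure_finite_Union)
      (auto simp: disjoint_family_on_def sum_distrib_right)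
  finally show ?thesis using DQ by simp
qed

section \<open>Conditional probabilities\<close>

lemma subalgebra_vimage_algebra:
  assumes "Y \<in> measurable M N"
  shows "subalgebra M (vimage_algebra (space M) Y N)"
  using assms measurable_sets[OF assms] measurable_space[OF assms]
  by (auto simp: subalgebra_def sets_vimage_algebra2)

lemma
  assumes M: "finite_measure M" and F: "subalgebra M F" and Q: "{\<omega> \<in> space M. Q \<omega>} \<in> sets M"
  shows integrable_cond_probability: "integrable M (cond_probability M F Q)"
    and cond_probability_measurable: "cond_probability M F Q \<in> borel_measurable F"
    and integral_cond_probability: "A \<in> sets F \<Longrightarrow>
      (\<integral>\<omega>\<in>A. cond_probability M F Q \<omega> \<partial>M) = measure M {\<omega> \<in> A. Q \<omega>}"
proof -
  interpret finite_measure_subalgebra M F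
    using M F by (simp add: finite_measure_subalgebra_def finite_measure_subalgebra_axioms_def)
  have int: "integrable M (indicator {\<omega> \<in> space M. Q \<omega>} :: _ \<Rightarrow> real)"
    using Q by (intro integrable_real_indicator) (auto simp: less_top[symmetric])
  then show "integrable M (cond_probability M F Q)"
    unfolding cond_probability_def by (rule real_cond_exp_int)
  show "cond_probability M F Q \<in> borel_measurable F"
    unfolding cond_probability_def by simp
  assume A: "A \<in> sets F"
  then have AM: "A \<in> sets M" using F by (auto simp: subalgebra_def)
  have "(\<integral>\<omega>\<in>A. cond_probability M F Q \<omega> \<partial>M) =
      (\<integral>\<omega>\<in>A. (indicator {\<omega> \<in> space M. Q \<omega>} \<omega> :: real) \<partial>M)"
    unfolding cond_probability_def by (rule real_cond_exp_intA[OF int A, symmetric])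
  also have "\<dots> = (\<integral>\<omega>. indicator (A \<inter> {\<omega> \<in> space M. Q \<omega>}) \<omega> \<partial>M)"
    unfolding set_lebesgue_integral_def
    by (intro Bochner_Integration.integral_cong) (auto simp: indicator_def)
  also have "\<dots> = measure M (A \<inter> {\<omega> \<in> space M. Q \<omega>})"
    using AM Q by simp
  also have "A \<inter> {\<omega> \<in> space M. Q \<omega>} = {\<omega> \<in> A. Q \<omega>}"
    using sets.sets_into_space[OF AM] by auto
  finally show "(\<integral>\<omega>\<in>A. cond_probability M F Q \<omega> \<partial>M) = measure M {\<omega> \<in> A. Q \<omega>}" .
qed

text \<open>The set where the conditional probability exceeds \<open>c\<close> belongs to
  \<open>F\<close>. Testing the hypothesis on it makes the integral of a nonnegative function at
  most zero, although this function is strictly positive on that set.\<close>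

lemma cond_probability_le:
  assumes M: "finite_measure M" and F: "subalgebra M F" and Q: "{\<omega> \<in> space M. Q \<omega>} \<in> sets M"
    and le: "\<And>A. A \<in> sets F \<Longrightarrow> measure M {\<omega> \<in> A. Q \<omega>} \<le> c * measure M A"
  shows "AE \<omega> in M. cond_probability M F Q \<omega> \<le> c"
proof -
  interpret finite_measure M by fact
  let ?f = "cond_probability M F Q"
  define A where "A = {\<omega> \<in> space F. ?f \<omega> > c}"
  note f = cond_probability_measurable[OF M F Q]
  have A: "A \<in> sets F" using f unfolding A_def by measurable
  then have AM: "A \<in> sets M" using F by (auto simp: subalgebra_def)
  note int = integrable_cond_probability[OF M F Q]
  have i1: "integrable M (\<lambda>\<omega>. indicator A \<omega> *\<^sub>R ?f \<omega>)" "integrable M (\<lambda>\<omega>. indicator A \<omega> *\<^sub>R c)"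
    using integrable_mult_indicator[OF AM int] integrable_mult_indicator[OF AM, of "\<lambda>_. c"] by auto
  have "(\<integral>\<omega>. indicator A \<omega> *\<^sub>R ?f \<omega> - indicator A \<omega> *\<^sub>R c \<partial>M) =
      measure M {\<omega> \<in> A. Q \<omega>} - c * measure M A"
    using integral_cond_probability[OF M F Q A] AM i1
    by (subst Bochner_Integration.integral_diff) (auto simp: set_lebesgue_integral_def)
  also have "\<dots> \<le> 0" using le[OF A] by simp
  finally have "(\<integral>\<omega>. indicator A \<omega> *\<^sub>R ?f \<omega> - indicator A \<omega> *\<^sub>R c \<partial>M) \<le> 0" .
  moreover have nn: "0 \<le> indicator A \<omega> *\<^sub>R ?f \<omega> - indicator A \<omega> *\<^sub>R c" for \<omega>
    by (auto simp: A_def indicator_def)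
  ultimately have "(\<integral>\<omega>. indicator A \<omega> *\<^sub>R ?f \<omega> - indicator A \<omega> *\<^sub>R c \<partial>M) = 0"
    by (intro antisym integral_nonneg_AE) auto
  then have "AE \<omega> in M. indicator A \<omega> *\<^sub>R ?f \<omega> - indicator A \<omega> *\<^sub>R c = 0"
    using integral_nonneg_eq_0_iff_AE[of M "\<lambda>\<omega>. indicator A \<omega> *\<^sub>R ?f \<omega> - indicator A \<omega> *\<^sub>R c"] nn i1
    by (auto intro: Bochner_Integration.integrable_diff)
  with AE_space show ?thesis
    by eventually_elim (use F in \<open>auto simp: A_def indicator_def subalgebra_def split: if_splits\<close>)
qed

text \<open>A function of \<open>Y\<close> is measurable for the sigma-algebra generated by
  \<open>Y\<close>, so matching its integrals over the events \<open>Y \<in> C\<close> identifies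
  the conditional probability. With nonnegative integrals in the hypothesis, integrability of
  \<open>g\<close> composed with \<open>Y\<close> follows from the case
  \<open>C = space N\<close>.\<close>

lemma cond_probability_eqI:
  assumes M: "finite_measure M" and Y: "Y \<in> measurable M N"
    and Q: "{\<omega> \<in> space M. Q \<omega>} \<in> sets M"
    and g: "g \<in> borel_measurable N" "\<And>y. 0 \<le> g y"
    and eq: "\<And>C. C \<in> sets N \<Longrightarrow> emeasure M {\<omega> \<in> space M. Q \<omega> \<and> Y \<omega> \<in> C} =
      (\<integral>\<^sup>+\<omega>. ennreal (g (Y \<omega>)) * indicator C (Y \<omega>) \<partial>M)"
  shows "AE \<omega> in M. cond_probability M (vimage_algebra (space M) Y N) Q \<omega> = g (Y \<omega>)"
proof -
  let ?F = "vimage_algebra (space M) Y N"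
  interpret finite_measure_subalgebra M ?F
    using M subalgebra_vimage_algebra[OF Y]
    by (simp add: finite_measure_subalgebra_def finite_measure_subalgebra_axioms_def)
  have Ysp: "Y \<in> space M \<rightarrow> space N" using measurable_space[OF Y] by auto
  have gM: "(\<lambda>\<omega>. g (Y \<omega>)) \<in> borel_measurable M" using g Y by measurable
  have "(\<integral>\<^sup>+\<omega>. ennreal (g (Y \<omega>)) \<partial>M) = (\<integral>\<^sup>+\<omega>. ennreal (g (Y \<omega>)) * indicator (space N) (Y \<omega>) \<partial>M)"
    using measurable_space[OF Y] by (intro nn_integral_cong) simp
  also have "\<dots> = emeasure M {\<omega> \<in> space M. Q \<omega> \<and> Y \<omega> \<in> space N}"
    using eq[OF sets.top] by simp
  also have "\<dots> < \<infinity>" by (simp add: less_top[symmetric])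
  finally have int: "integrable M (\<lambda>\<omega>. g (Y \<omega>))"
    using gM g(2) by (intro integrableI_nonneg) auto
  have int2: "integrable M (indicator {\<omega> \<in> space M. Q \<omega>} :: _ \<Rightarrow> real)"
    using Q by (intro integrable_real_indicator) (auto simp: less_top[symmetric])
  show ?thesis
    unfolding cond_probability_def
  proof (rule real_cond_exp_charact[OF _ int2 int])
    show "(\<lambda>\<omega>. g (Y \<omega>)) \<in> borel_measurable ?F"
      using measurable_vimage_algebra1[OF Ysp] g(1) by (rule measurable_compose)
    fix A assume "A \<in> sets ?F"
    then obtain C where C: "C \<in> sets N" "A = Y -` C \<inter> space M"
      using Ysp by (auto simp: sets_vimage_algebra2)
    have YC: "{\<omega> \<in> space M. Q \<omega> \<and> Y \<omega> \<in> C} \<in> sets M"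
    proof -
      have "{\<omega> \<in> space M. Q \<omega> \<and> Y \<omega> \<in> C} = {\<omega> \<in> space M. Q \<omega>} \<inter> (Y -` C \<inter> space M)" by auto
      then show ?thesis using Q measurable_sets[OF Y C(1)] by simp
    qed
    have "(\<integral>\<omega>\<in>A. (indicator {\<omega> \<in> space M. Q \<omega>} \<omega> :: real) \<partial>M) =
        (\<integral>\<omega>. indicator {\<omega> \<in> space M. Q \<omega> \<and> Y \<omega> \<in> C} \<omega> \<partial>M)"
      unfolding set_lebesgue_integral_def C(2)
      by (intro Bochner_Integration.integral_cong) (auto simp: indicator_def)
    also have "\<dots> = enn2real (emeasure M {\<omega> \<in> space M. Q \<omega> \<and> Y \<omega> \<in> C})"
      using YC by (simp add: measure_def)
    also have "\<dots> = enn2real (\<integral>\<^sup>+\<omega>. ennreal (g (Y \<omega>) * indicator C (Y \<omega>)) \<partial>M)"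
      unfolding eq[OF C(1)]
      by (intro arg_cong[of _ _ enn2real] nn_integral_cong) (auto simp: indicator_def)
    also have "\<dots> = (\<integral>\<omega>. g (Y \<omega>) * indicator C (Y \<omega>) \<partial>M)"
      using g Y C(1) by (intro integral_eq_nn_integral[symmetric]) auto
    also have "\<dots> = (\<integral>\<omega>\<in>A. g (Y \<omega>) \<partial>M)"
      unfolding set_lebesgue_integral_def C(2)
      by (intro Bochner_Integration.integral_cong) (auto simp: indicator_def)
    finally show "(\<integral>\<omega>\<in>A. (indicator {\<omega> \<in> space M. Q \<omega>} \<omega> :: real) \<partial>M) = (\<integral>\<omega>\<in>A. g (Y \<omega>) \<partial>M)" .
  qed
qed

section \<open>Conditioning under a product law\<close>

text \<open>The product form of the joint law says that \<open>X\<close> is independent of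
  \<open>Y\<close> with law \<open>L\<close>; Fubini then integrates \<open>X\<close> out and leaves
  the measure of a section.\<close>

lemma nn_integral_Pair_indicator:
  assumes "finite_measure L" and N: "distr M (N \<Otimes>\<^sub>M L) (\<lambda>\<omega>. (Y \<omega>, X \<omega>)) = distr M N Y \<Otimes>\<^sub>M L"
    and Y: "Y \<in> measurable M N" and X: "X \<in> measurable M L"
    and D: "D \<in> sets (N \<Otimes>\<^sub>M L)" and f: "f \<in> borel_measurable N"
  shows "(\<integral>\<^sup>+\<omega>. f (Y \<omega>) * indicator D (Y \<omega>, X \<omega>) \<partial>M) =
    (\<integral>\<^sup>+y. f y * emeasure L (Pair y -` D) \<partial>distr M N Y)"
proof -
  interpret finite_measure L by fact
  have fm [measurable]: "(\<lambda>p. f (fst p)) \<in> borel_measurable (N \<Otimes>\<^sub>M L)"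
    using measurable_fst f by (rule measurable_compose)
  have [measurable]: "D \<in> sets (N \<Otimes>\<^sub>M L)" "Y \<in> measurable M N" "X \<in> measurable M L" by fact+
  have "(\<integral>\<^sup>+\<omega>. f (Y \<omega>) * indicator D (Y \<omega>, X \<omega>) \<partial>M) =
      (\<integral>\<^sup>+p. f (fst p) * indicator D p \<partial>distr M (N \<Otimes>\<^sub>M L) (\<lambda>\<omega>. (Y \<omega>, X \<omega>)))"
    by (subst nn_integral_distr) auto
  also have "\<dots> = (\<integral>\<^sup>+y. \<integral>\<^sup>+x. f y * indicator D (y, x) \<partial>L \<partial>distr M N Y)"
    unfolding N by (subst nn_integral_fst[symmetric]) auto
  also have "\<dots> = (\<integral>\<^sup>+y. f y * emeasure L (Pair y -` D) \<partial>distr M N Y)"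
  proof (intro nn_integral_cong)
    fix y
    have "(\<integral>\<^sup>+x. f y * indicator D (y, x) \<partial>L) = (\<integral>\<^sup>+x. f y * indicator (Pair y -` D) x \<partial>L)"
      by (intro nn_integral_cong) (auto simp: indicator_def)
    then show "(\<integral>\<^sup>+x. f y * indicator D (y, x) \<partial>L) = f y * emeasure L (Pair y -` D)"
      using sets_Pair1[OF D, of y] by (simp add: nn_integral_cmult_indicator)
  qed
  finally show ?thesis .
qed

text \<open>The equation holds almost surely for \<open>M\<close>, not just on the conditioning event, since both
  sides are functions of \<open>Y\<close> and the event has positive probability given \<open>Y\<close>.\<close>

lemma cond_probability_product:
  assumes M: "prob_space M" and L: "prob_space L"
    and Y: "Y \<in> measurable M N" and X: "X \<in> measurable M L"
    and N: "distr M (N \<Otimes>\<^sub>M L) (\<lambda>\<omega>. (Y \<omega>, X \<omega>)) = distr M N Y \<Otimes>\<^sub>M L"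
    and D: "D \<in> sets (N \<Otimes>\<^sub>M L)" and E: "E \<in> sets (N \<Otimes>\<^sub>M L)"
    and pos: "\<And>y. y \<in> space N \<Longrightarrow> measure L (Pair y -` E) > 0"
  shows "AE \<omega> in M. cond_probability (uniform_measure M {\<omega> \<in> space M. (Y \<omega>, X \<omega>) \<in> E})
      (vimage_algebra (space M) Y N) (\<lambda>\<omega>. (Y \<omega>, X \<omega>) \<in> D) \<omega> =
      measure L (Pair (Y \<omega>) -` (D \<inter> E)) / measure L (Pair (Y \<omega>) -` E)"
proof -
  interpret M: prob_space M by fact
  interpret L: prob_space L by fact
  have [measurable]: "D \<in> sets (N \<Otimes>\<^sub>M L)" "E \<in> sets (N \<Otimes>\<^sub>M L)" "Y \<in> measurable M N"
    "X \<in> measurable M L" by fact+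
  have DE: "D \<inter> E \<in> sets (N \<Otimes>\<^sub>M L)" using D E by blast
  define EE where "EE = {\<omega> \<in> space M. (Y \<omega>, X \<omega>) \<in> E}"
  define U where "U = uniform_measure M EE"
  define h where "h y = emeasure L (Pair y -` E)" for y
  define g where "g y = measure L (Pair y -` (D \<inter> E)) / measure L (Pair y -` E)" for y
  have EE [measurable]: "EE \<in> sets M" unfolding EE_def by measurable
  have hm [measurable]: "h \<in> borel_measurable N"
    unfolding h_def by (rule L.measurable_emeasure_Pair[OF E])
  have gm [measurable]: "g \<in> borel_measurable N"
    unfolding g_def measure_def using L.measurable_emeasure_Pair[OF E] L.measurable_emeasure_Pair[OF DE]
    by measurable
  have hpos: "h y > 0" if "y \<in> space N" for y
    using pos[OF that] unfolding h_def L.emeasure_eq_measure by simp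
  have gh: "ennreal (g y) * h y = emeasure L (Pair y -` (D \<inter> E))" if "y \<in> space N" for y
    using pos[OF that] unfolding g_def h_def L.emeasure_eq_measure
    by (simp add: ennreal_mult'[symmetric])
  note int = nn_integral_Pair_indicator[OF L.finite_measure_axioms N Y X]
  have inE: "emeasure M {\<omega> \<in> space M. Y \<omega> \<in> C \<and> (Y \<omega>, X \<omega>) \<in> B} =
      (\<integral>\<^sup>+y. indicator C y * emeasure L (Pair y -` B) \<partial>distr M N Y)"
    if C: "C \<in> sets N" and B: "B \<in> sets (N \<Otimes>\<^sub>M L)" for B C
  proof -
    have [measurable]: "C \<in> sets N" "B \<in> sets (N \<Otimes>\<^sub>M L)" by fact+
    have "emeasure M {\<omega> \<in> space M. Y \<omega> \<in> C \<and> (Y \<omega>, X \<omega>) \<in> B} =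
       (\<integral>\<^sup>+\<omega>. indicator {\<omega> \<in> space M. Y \<omega> \<in> C \<and> (Y \<omega>, X \<omega>) \<in> B} \<omega> \<partial>M)"
      by simp
    also have "\<dots> = (\<integral>\<^sup>+\<omega>. indicator C (Y \<omega>) * indicator B (Y \<omega>, X \<omega>) \<partial>M)"
      by (intro nn_integral_cong) (auto simp: indicator_def)
    also have "\<dots> = (\<integral>\<^sup>+y. indicator C y * emeasure L (Pair y -` B) \<partial>distr M N Y)"
      using C by (intro int[OF B]) auto
    finally show ?thesis .
  qed
  \<comment> \<open>The weight \<open>h\<close> is the conditional probability of \<open>E\<close>
    given \<open>Y\<close> and is positive everywhere, so an event about \<open>Y\<close> that is
    null within \<open>E\<close> is null outright. This is what carries statements from
    \<open>U\<close> back to \<open>M\<close>.\<close>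
  have zero: "emeasure M (Y -` C \<inter> space M) = 0"
    if C: "C \<in> sets N" and "emeasure M {\<omega> \<in> space M. Y \<omega> \<in> C \<and> (Y \<omega>, X \<omega>) \<in> E} = 0" for C
  proof -
    have [measurable]: "C \<in> sets N" by fact
    have "(\<integral>\<^sup>+y. indicator C y * h y \<partial>distr M N Y) = 0"
      using inE[OF C E] that(2) by (simp add: h_def)
    then have "AE y in distr M N Y. indicator C y * h y = 0"
      by (subst (asm) nn_integral_0_iff_AE) auto
    then have "AE \<omega> in M. indicator C (Y \<omega>) * h (Y \<omega>) = 0"
      by (subst (asm) AE_distr_iff) auto
    then have "AE \<omega> in M. Y \<omega> \<notin> C"
      using AE_space
    proof eventually_elim
      case (elim \<omega>)
      then show ?case
        using hpos[OF measurable_space[OF Y elim(2)]] by (auto simp: indicator_def split: if_splits)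
    qed
    then show ?thesis
      by (subst (asm) AE_iff_measurable[OF _ refl]) (auto simp: vimage_def Int_def conj_commute)
  qed
  have EEpos: "emeasure M EE \<noteq> 0"
  proof
    assume "emeasure M EE = 0"
    moreover have "{\<omega> \<in> space M. Y \<omega> \<in> space N \<and> (Y \<omega>, X \<omega>) \<in> E} = EE"
      using measurable_space[OF Y] by (auto simp: EE_def)
    ultimately have "emeasure M (Y -` space N \<inter> space M) = 0" using zero[OF sets.top] by simp
    moreover have "Y -` space N \<inter> space M = space M" using measurable_space[OF Y] by auto
    ultimately show False using M.emeasure_space_1 by simp
  qed
  have U: "prob_space U"
    unfolding U_def using EEpos by (intro prob_space_uniform_measure) auto
  interpret U: prob_space U by fact
  have YU: "Y \<in> measurable U N" using Y by (simp add: U_def)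
  have spU: "space U = space M" "sets U = sets M" by (auto simp: U_def)
  have ae: "AE \<omega> in U. cond_probability U (vimage_algebra (space U) Y N) (\<lambda>\<omega>. (Y \<omega>, X \<omega>) \<in> D) \<omega> = g (Y \<omega>)"
  proof (rule cond_probability_eqI[OF U.finite_measure_axioms YU _ gm])
    show "{\<omega> \<in> space U. (Y \<omega>, X \<omega>) \<in> D} \<in> sets U" unfolding spU by measurable
    show "0 \<le> g y" for y by (simp add: g_def)
    fix C assume C: "C \<in> sets N"
    have [measurable]: "C \<in> sets N" by fact
    have "emeasure U {\<omega> \<in> space U. (Y \<omega>, X \<omega>) \<in> D \<and> Y \<omega> \<in> C} =
        emeasure M (EE \<inter> {\<omega> \<in> space M. (Y \<omega>, X \<omega>) \<in> D \<and> Y \<omega> \<in> C}) / emeasure M EE"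
      unfolding spU unfolding U_def by (subst emeasure_uniform_measure) auto
    also have "EE \<inter> {\<omega> \<in> space M. (Y \<omega>, X \<omega>) \<in> D \<and> Y \<omega> \<in> C} =
        {\<omega> \<in> space M. Y \<omega> \<in> C \<and> (Y \<omega>, X \<omega>) \<in> D \<inter> E}"
      by (auto simp: EE_def)
    also have "emeasure M \<dots> = (\<integral>\<^sup>+y. indicator C y * emeasure L (Pair y -` (D \<inter> E)) \<partial>distr M N Y)"
      by (rule inE[OF C DE])
    \<comment> \<open>Replacing the section of \<open>D \<inter> E\<close> by \<open>g\<close> times
      the section of \<open>E\<close> allows Fubini to be run backwards; the indicator of
      \<open>E\<close> that reappears is absorbed by the conditioned measure.\<close>
    also have "\<dots> = (\<integral>\<^sup>+y. (ennreal (g y) * indicator C y) * emeasure L (Pair y -` E) \<partial>distr M N Y)"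
      using gh unfolding h_def by (intro nn_integral_cong) (auto simp: indicator_def)
    also have "\<dots> = (\<integral>\<^sup>+\<omega>. (ennreal (g (Y \<omega>)) * indicator C (Y \<omega>)) * indicator E (Y \<omega>, X \<omega>) \<partial>M)"
      by (intro int[OF E, symmetric]) measurable
    also have "\<dots> = (\<integral>\<^sup>+\<omega>. (ennreal (g (Y \<omega>)) * indicator C (Y \<omega>)) * indicator EE \<omega> \<partial>M)"
      by (intro nn_integral_cong) (auto simp: EE_def indicator_def)
    also have "\<dots> / emeasure M EE = (\<integral>\<^sup>+\<omega>. ennreal (g (Y \<omega>)) * indicator C (Y \<omega>) \<partial>U)"
      unfolding U_def by (intro nn_integral_uniform_measure[symmetric]) measurable
    finally show "emeasure U {\<omega> \<in> space U. (Y \<omega>, X \<omega>) \<in> D \<and> Y \<omega> \<in> C} =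
        (\<integral>\<^sup>+\<omega>. ennreal (g (Y \<omega>)) * indicator C (Y \<omega>) \<partial>U)" .
  qed
  define cp where "cp = cond_probability U (vimage_algebra (space M) Y N) (\<lambda>\<omega>. (Y \<omega>, X \<omega>) \<in> D)"
  let ?F = "vimage_algebra (space M) Y N"
  have cpF: "cp \<in> borel_measurable ?F"
    unfolding cp_def
    using cond_probability_measurable[OF U.finite_measure_axioms subalgebra_vimage_algebra[OF YU]]
    by (auto simp: spU)
  have Ysp: "Y \<in> space M \<rightarrow> space N" using measurable_space[OF Y] by auto
  have gF: "(\<lambda>\<omega>. g (Y \<omega>)) \<in> borel_measurable ?F"
    using measurable_vimage_algebra1[OF Ysp] gm by (rule measurable_compose)
  \<comment> \<open>Both sides are measurable for the sigma-algebra of \<open>Y\<close>, so the set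
    where they differ has the form \<open>Y \<in> C\<close>, to which \<open>zero\<close>
    applies.\<close>
  have "{\<omega> \<in> space ?F. cp \<omega> \<noteq> g (Y \<omega>)} \<in> sets ?F" using cpF gF by measurable
  then obtain C where C: "C \<in> sets N" "{\<omega> \<in> space M. cp \<omega> \<noteq> g (Y \<omega>)} = Y -` C \<inter> space M"
    using Ysp by (auto simp: sets_vimage_algebra2)
  have [measurable]: "C \<in> sets N" by fact
  have "AE \<omega> in M. \<omega> \<in> EE \<longrightarrow> cp \<omega> = g (Y \<omega>)"
    using ae EEpos unfolding spU cp_def[symmetric] unfolding U_def
    by (subst (asm) AE_uniform_measure) (auto simp: less_top[symmetric])
  then have "AE \<omega> in M. \<not> (Y \<omega> \<in> C \<and> (Y \<omega>, X \<omega>) \<in> E)"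
    using AE_space
  proof eventually_elim
    case (elim \<omega>)
    then show ?case using C(2) by (auto simp: EE_def)
  qed
  then have "emeasure M {\<omega> \<in> space M. Y \<omega> \<in> C \<and> (Y \<omega>, X \<omega>) \<in> E} = 0"
    by (subst (asm) AE_iff_measurable[OF _ refl]) auto
  from zero[OF C(1) this] have "emeasure M {\<omega> \<in> space M. cp \<omega> \<noteq> g (Y \<omega>)} = 0"
    unfolding C(2) .
  then have "AE \<omega> in M. cp \<omega> = g (Y \<omega>)"
    using C measurable_sets[OF Y C(1)] by (subst AE_iff_measurable[OF _ refl]) auto
  then show ?thesis unfolding cp_def U_def EE_def g_def .
qed

section \<open>A common null set in condition (b)\<close>

text \<open>The rational rays are countable and generate. The whole line is added because the
  criterion for independence on generators requires the full space among them.\<close>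

lemma sets_borel_rational_lessThan:
  "sets (borel :: real measure) = sigma_sets UNIV (insert UNIV (range (\<lambda>q::rat. {..<of_rat q})))"
proof -
  let ?E = "insert UNIV (range (\<lambda>q::rat. {..<of_rat q :: real}))"
  have "borel = sigma UNIV ?E"
  proof (rule borel_eq_sigmaI1[OF borel_eq_lessThan[where 'a = real], where F = "\<lambda>x. x" and A = ?E, simplified image_ident])
    fix X :: "real set" assume "X \<in> range (\<lambda>a. {x. eucl_less x a})"
    then obtain a :: real where X: "X = {..<a}" by (auto simp: eucl_lessThan)
    have "X = \<Union>((\<lambda>q::rat. {..<of_rat q}) ` {q. of_rat q \<le> a})"
    proof (intro set_eqI iffI)
      fix x assume "x \<in> X"
      then obtain q where "x < of_rat q" "of_rat q < a" using of_rat_dense X by blast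
      then show "x \<in> \<Union>((\<lambda>q::rat. {..<of_rat q}) ` {q. of_rat q \<le> a})"
        by (auto intro!: exI[of _ q])
    next
      fix x :: real assume "x \<in> \<Union>((\<lambda>q::rat. {..<of_rat q}) ` {q. of_rat q \<le> a})"
      then show "x \<in> X" unfolding X by auto
    qed
    also have "\<dots> \<in> sets (sigma UNIV ?E)"
      by (intro sets.countable_UN') auto
    finally show "X \<in> sets (sigma UNIV ?E)" .
  qed auto
  then have "sets borel = sets (sigma UNIV ?E)" by simp
  then show ?thesis by simp
qed

lemma Int_stable_rational_lessThan:
  "Int_stable (insert UNIV (range (\<lambda>q::rat. {..<of_rat q :: real})))"
proof -
  have "{..<of_rat p} \<inter> {..<of_rat q :: real} = {..<of_rat (min p q)}" for p q :: rat
    by (auto simp: min_def of_rat_less_eq intro: less_le_trans)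
  then show ?thesis unfolding Int_stable_def by blast
qed

text \<open>The null sets in the definition of conditional independence depend on the Borel sets;
  a countable generator that is closed under intersections gives one null set for all of them.\<close>

lemma AE_product_rule:
  fixes f :: "'k \<Rightarrow> 'w \<Rightarrow> 'z \<Rightarrow> real"
  assumes M: "prob_space M" and L: "prob_space L"
    and W: "W \<in> measurable M MW" and Z: "Z \<in> measurable M L"
    and law: "distr M (MW \<Otimes>\<^sub>M L) (\<lambda>\<omega>. (W \<omega>, Z \<omega>)) = distr M MW W \<Otimes>\<^sub>M L"
    and S: "S \<in> sets L" and pos: "measure L S > 0"
    and J: "finite J" "J \<noteq> {}"
    and f: "\<And>k. k \<in> J \<Longrightarrow> (\<lambda>(w, z). f k w z) \<in> borel_measurable (MW \<Otimes>\<^sub>M L)"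
    and ci: "cond_indep_vars (uniform_measure M {\<omega> \<in> space M. Z \<omega> \<in> S})
      (vimage_algebra (space M) W MW) (\<lambda>_. borel) (\<lambda>k \<omega>. f k (W \<omega>) (Z \<omega>)) J"
  shows "AE \<omega> in M. \<forall>B. (\<forall>k\<in>J. B k \<in> sets borel) \<longrightarrow>
    measure L {z \<in> S. \<forall>k\<in>J. f k (W \<omega>) z \<in> B k} / measure L S =
    (\<Prod>k\<in>J. measure L {z \<in> S. f k (W \<omega>) z \<in> B k} / measure L S)"
proof -
  interpret M: prob_space M by fact
  interpret L: prob_space L by fact
  have [measurable]: "S \<in> sets L" "W \<in> measurable M MW" "Z \<in> measurable M L" by fact+
  define G where "G = insert UNIV (range (\<lambda>q::rat. {..<of_rat q :: real}))"
  have G: "B \<in> sets borel" if "B \<in> G" for B using that by (auto simp: G_def)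
  define U where "U = uniform_measure M {\<omega> \<in> space M. Z \<omega> \<in> S}"
  have MS: "measure M {\<omega> \<in> space M. Z \<omega> \<in> S} = measure L S"
  proof -
    have "emeasure M {\<omega> \<in> space M. Z \<omega> \<in> S} =
        emeasure (distr M (MW \<Otimes>\<^sub>M L) (\<lambda>\<omega>. (W \<omega>, Z \<omega>))) (space MW \<times> S)"
      using measurable_space[OF W] by (subst emeasure_distr) (auto intro!: arg_cong[of _ _ "emeasure M"])
    also have "\<dots> = emeasure (distr M MW W) (space MW) * emeasure L S"
      unfolding law by (subst L.emeasure_pair_measure_Times) auto
    also have "\<dots> = emeasure L S"
      using prob_space.emeasure_space_1[OF M.prob_space_distr[OF W]] by simp
    finally show ?thesis by (simp add: measure_def)
  qed
  define e where "e w D = measure L {z \<in> S. (w, z) \<in> D} / measure L S" for w :: 'w and D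
  \<comment> \<open>This is \<open>cond_probability_product\<close> with \<open>W\<close> as the
    conditioning variable and \<open>space MW \<times> S\<close> as the event; all sections of that
    event equal \<open>S\<close>.\<close>
  have cp: "AE \<omega> in M. cond_probability U (vimage_algebra (space M) W MW) Q \<omega> = e (W \<omega>) D"
    if D: "D \<in> sets (MW \<Otimes>\<^sub>M L)" and Q: "Q = (\<lambda>\<omega>. (W \<omega>, Z \<omega>) \<in> D)" for D Q
  proof -
    let ?E = "space MW \<times> S"
    have E: "?E \<in> sets (MW \<Otimes>\<^sub>M L)" by measurable
    have sec: "Pair w -` ?E = S" "Pair w -` (D \<inter> ?E) = {z \<in> S. (w, z) \<in> D}" if "w \<in> space MW" for w
      using that by auto
    have "{\<omega> \<in> space M. (W \<omega>, Z \<omega>) \<in> ?E} = {\<omega> \<in> space M. Z \<omega> \<in> S}"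
      using measurable_space[OF W] by auto
    then have "AE \<omega> in M. cond_probability U (vimage_algebra (space M) W MW) Q \<omega> =
       measure L (Pair (W \<omega>) -` (D \<inter> ?E)) / measure L (Pair (W \<omega>) -` ?E)"
      using cond_probability_product[OF M L W Z law D E] sec(1) pos unfolding U_def Q by simp
    then show ?thesis
      using AE_space
    proof eventually_elim
      case (elim \<omega>)
      then show ?case using sec[OF measurable_space[OF W elim(2)]] by (simp add: e_def)
    qed
  qed
  have Dm: "{p \<in> space (MW \<Otimes>\<^sub>M L). \<forall>k\<in>H. f k (fst p) (snd p) \<in> B k} \<in> sets (MW \<Otimes>\<^sub>M L)"
    if "H \<subseteq> J" "\<And>k. k \<in> H \<Longrightarrow> B k \<in> sets borel" for H B
  proof (rule sets.sets_Collect_finite_All)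
    show "finite H" using that J finite_subset by blast
    fix k assume k: "k \<in> H"
    then have "(\<lambda>p. f k (fst p) (snd p)) \<in> borel_measurable (MW \<Otimes>\<^sub>M L)"
      using f[of k] that(1) by (auto simp: case_prod_beta')
    then show "{p \<in> space (MW \<Otimes>\<^sub>M L). f k (fst p) (snd p) \<in> B k} \<in> sets (MW \<Otimes>\<^sub>M L)"
      using that(2)[OF k] by measurable
  qed
  define D where "D B H = {p \<in> space (MW \<Otimes>\<^sub>M L). \<forall>k\<in>H. f k (fst p) (snd p) \<in> B k}" for B H
  have eD: "e w (D B H) = measure L {z \<in> S. \<forall>k\<in>H. f k w z \<in> B k} / measure L S"
    if "w \<in> space MW" for w B H
    using that sets.sets_into_space[OF S] unfolding e_def D_def
    by (intro arg_cong2[of _ _ _ _ "(/)"] arg_cong[of _ _ "measure L"]) (auto simp: space_pair_measure)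
  have em: "(\<lambda>w. e w D) \<in> borel_measurable MW" if D: "D \<in> sets (MW \<Otimes>\<^sub>M L)" for D
  proof -
    have DS: "D \<inter> (space MW \<times> S) \<in> sets (MW \<Otimes>\<^sub>M L)" using D by measurable
    have "(\<lambda>w. enn2real (emeasure L (Pair w -` (D \<inter> (space MW \<times> S)))) / measure L S) \<in> borel_measurable MW"
      using L.measurable_emeasure_Pair[OF DS] by measurable
    moreover have "e w D = enn2real (emeasure L (Pair w -` (D \<inter> (space MW \<times> S)))) / measure L S"
      if "w \<in> space MW" for w
      using that unfolding e_def measure_def
      by (intro arg_cong2[of _ _ _ _ "(/)"] arg_cong[of _ _ enn2real] arg_cong[of _ _ "emeasure L"]) auto
    ultimately show ?thesis by (subst measurable_cong)
  qed
  have one: "AE \<omega> in M. e (W \<omega>) (D B J) = (\<Prod>k\<in>J. e (W \<omega>) (D B {k}))"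
    if B: "\<And>k. k \<in> J \<Longrightarrow> B k \<in> sets borel" for B
  proof -
    have DJ: "D B J \<in> sets (MW \<Otimes>\<^sub>M L)" unfolding D_def by (rule Dm) (use B in auto)
    have Dk: "D B {k} \<in> sets (MW \<Otimes>\<^sub>M L)" if "k \<in> J" for k
      unfolding D_def by (rule Dm) (use B that in auto)
    let ?F = "vimage_algebra (space M) W MW"
    have sp: "(W \<omega>, Z \<omega>) \<in> D B H \<longleftrightarrow> (\<forall>k\<in>H. f k (W \<omega>) (Z \<omega>) \<in> B k)" if "\<omega> \<in> space M" for \<omega> H
      using measurable_space[OF W that] measurable_space[OF Z that]
      by (auto simp: D_def space_pair_measure)
    have cong: "cond_probability U ?F (\<lambda>\<omega>. (W \<omega>, Z \<omega>) \<in> D B H) =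
        cond_probability U ?F (\<lambda>\<omega>. \<forall>k\<in>H. f k (W \<omega>) (Z \<omega>) \<in> B k)" for H
    proof -
      have "{\<omega> \<in> space U. (W \<omega>, Z \<omega>) \<in> D B H} = {\<omega> \<in> space U. \<forall>k\<in>H. f k (W \<omega>) (Z \<omega>) \<in> B k}"
        using sp by (auto simp: U_def)
      then show ?thesis unfolding cond_probability_def by (simp only:)
    qed
    have "AE \<omega> in M. \<forall>k\<in>J. cond_probability U ?F (\<lambda>\<omega>. (W \<omega>, Z \<omega>) \<in> D B {k}) \<omega> = e (W \<omega>) (D B {k})"
      using J(1) cp[OF Dk refl] by (intro AE_finite_allI)
    moreover have "AE \<omega> in M. cond_probability U ?F (\<lambda>\<omega>. (W \<omega>, Z \<omega>) \<in> D B J) \<omega> = e (W \<omega>) (D B J)"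
      by (rule cp[OF DJ refl])
    moreover have "AE \<omega> in M. Z \<omega> \<in> S \<longrightarrow>
       cond_probability U ?F (\<lambda>\<omega>. (W \<omega>, Z \<omega>) \<in> D B J) \<omega> =
       (\<Prod>k\<in>J. cond_probability U ?F (\<lambda>\<omega>. (W \<omega>, Z \<omega>) \<in> D B {k}) \<omega>)"
    proof -
      have "AE \<omega> in U. cond_probability U ?F (\<lambda>\<omega>. \<forall>k\<in>J. f k (W \<omega>) (Z \<omega>) \<in> B k) \<omega> =
         (\<Prod>k\<in>J. cond_probability U ?F (\<lambda>\<omega>. f k (W \<omega>) (Z \<omega>) \<in> B k) \<omega>)"
        using ci B unfolding cond_indep_vars_def U_def by blast
      then have "AE \<omega> in U. cond_probability U ?F (\<lambda>\<omega>. (W \<omega>, Z \<omega>) \<in> D B J) \<omega> =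
         (\<Prod>k\<in>J. cond_probability U ?F (\<lambda>\<omega>. (W \<omega>, Z \<omega>) \<in> D B {k}) \<omega>)"
        unfolding cong by simp
      then have "AE \<omega> in M. \<omega> \<in> {\<omega> \<in> space M. Z \<omega> \<in> S} \<longrightarrow>
         cond_probability U ?F (\<lambda>\<omega>. (W \<omega>, Z \<omega>) \<in> D B J) \<omega> =
         (\<Prod>k\<in>J. cond_probability U ?F (\<lambda>\<omega>. (W \<omega>, Z \<omega>) \<in> D B {k}) \<omega>)"
        using MS pos M.emeasure_eq_measure unfolding U_def
        by (subst (asm) AE_uniform_measure) (auto simp: less_top[symmetric])
      with AE_space show ?thesis by eventually_elim simp
    qed
    ultimately have ae: "AE \<omega> in M. Z \<omega> \<in> S \<longrightarrow> e (W \<omega>) (D B J) = (\<Prod>k\<in>J. e (W \<omega>) (D B {k}))"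
      by eventually_elim simp
    \<comment> \<open>So far the product rule is known only where \<open>Z\<close> lies in
      \<open>S\<close>. The exceptional set \<open>V\<close> involves \<open>W\<close> alone, and
      the product law gives \<open>V \<times> S\<close> the product of the two masses; since
      \<open>S\<close> has positive mass, \<open>V\<close> is null.\<close>
    define V where "V = {w \<in> space MW. e w (D B J) \<noteq> (\<Prod>k\<in>J. e w (D B {k}))}"
    have V [measurable]: "V \<in> sets MW"
      unfolding V_def using em[OF DJ] borel_measurable_prod[of J "\<lambda>k w. e w (D B {k})" MW] em[OF Dk]
      by measurable
    have "AE \<omega> in M. (W \<omega>, Z \<omega>) \<notin> V \<times> S"
      using ae by eventually_elim (auto simp: V_def)
    then have "emeasure M ((\<lambda>\<omega>. (W \<omega>, Z \<omega>)) -` (V \<times> S) \<inter> space M) = 0"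
      by (subst (asm) AE_iff_measurable[OF _ refl])
        (auto simp: vimage_def Int_def conj_commute)
    then have "emeasure (distr M (MW \<Otimes>\<^sub>M L) (\<lambda>\<omega>. (W \<omega>, Z \<omega>))) (V \<times> S) = 0"
      by (subst emeasure_distr) auto
    then have "emeasure (distr M MW W) V * emeasure L S = 0"
      unfolding law by (subst (asm) L.emeasure_pair_measure_Times) auto
    then have "emeasure M (W -` V \<inter> space M) = 0"
      using pos by (auto simp: L.emeasure_eq_measure emeasure_distr)
    then have "AE \<omega> in M. W \<omega> \<notin> V"
      by (subst AE_iff_measurable[OF _ refl]) (auto simp: vimage_def Int_def conj_commute)
    with AE_space show ?thesis
      by eventually_elim (use measurable_space[OF W] in \<open>auto simp: V_def\<close>)
  qed
  \<comment> \<open>Extensional functions are used so that the families of generators are countable;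
    values outside \<open>J\<close> would otherwise be arbitrary.\<close>
  have "countable (PiE J (\<lambda>_. G))"
    using J by (intro countable_PiE) (auto simp: G_def)
  then have "AE \<omega> in M. \<forall>B\<in>PiE J (\<lambda>_. G). e (W \<omega>) (D B J) = (\<Prod>k\<in>J. e (W \<omega>) (D B {k}))"
    using one G by (subst AE_ball_countable) (auto simp: PiE_iff)
  with AE_space show ?thesis
  proof eventually_elim
    case (elim \<omega>)
    define w where "w = W \<omega>"
    have w: "w \<in> space MW" using measurable_space[OF W elim(1)] by (simp add: w_def)
    define V where "V = uniform_measure L S"
    interpret V: prob_space V
      unfolding V_def using pos by (intro prob_space_uniform_measure) (auto simp: L.emeasure_eq_measure)
    have fk: "f k w \<in> borel_measurable L" if "k \<in> J" for k
      using measurable_compose[OF measurable_Pair1'[OF w] f[OF that]] by simp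
    have rv: "V.random_variable borel (f k w)" if "k \<in> J" for k
      using fk[OF that] by (simp add: V_def)
    have prob: "V.prob (\<Inter>k\<in>H. f k w -` B k \<inter> space V) =
        measure L {z \<in> S. \<forall>k\<in>H. f k w z \<in> B k} / measure L S"
      if "H \<subseteq> J" "H \<noteq> {}" "\<And>k. k \<in> H \<Longrightarrow> B k \<in> sets borel" for H B
    proof -
      have "(\<Inter>k\<in>H. f k w -` B k \<inter> space V) \<in> sets L"
        using that fk J finite_subset[OF that(1) J(1)]
        by (intro sets.finite_INT) (auto simp: V_def intro: measurable_sets)
      then have "V.prob (\<Inter>k\<in>H. f k w -` B k \<inter> space V) =
          measure L (S \<inter> (\<Inter>k\<in>H. f k w -` B k \<inter> space V)) / measure L S"
        unfolding V_def using pos by (subst measure_uniform_measure) (auto simp: L.emeasure_eq_measure)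
      also have "S \<inter> (\<Inter>k\<in>H. f k w -` B k \<inter> space V) = {z \<in> S. \<forall>k\<in>H. f k w z \<in> B k}"
        using sets.sets_into_space[OF S] that(2) by (auto simp: V_def)
      finally show ?thesis .
    qed
    \<comment> \<open>With \<open>W\<close> fixed, the rule on the generators is ordinary
      independence under the law of \<open>Z\<close> conditioned on \<open>S\<close>, which extends
      to all Borel sets at once.\<close>
    have ind: "V.indep_vars (\<lambda>_. borel) (\<lambda>k. f k w) J"
    proof (subst V.indep_vars_finite[OF J(2,1), where E = "\<lambda>_. G"])
      show "sets borel = sigma_sets (space borel) G"
        unfolding G_def using sets_borel_rational_lessThan by simp
      show "Int_stable G" unfolding G_def by (rule Int_stable_rational_lessThan)
      show "\<forall>A\<in>J \<rightarrow> G. V.prob (\<Inter>j\<in>J. f j w -` A j \<inter> space V) =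
          (\<Prod>j\<in>J. V.prob (f j w -` A j \<inter> space V))"
      proof
        fix A assume A: "A \<in> J \<rightarrow> G"
        then have "restrict A J \<in> PiE J (\<lambda>_. G)" by auto
        then have "e w (D (restrict A J) J) = (\<Prod>k\<in>J. e w (D (restrict A J) {k}))"
          using elim(2) unfolding w_def by blast
        then have "measure L {z \<in> S. \<forall>k\<in>J. f k w z \<in> A k} / measure L S =
            (\<Prod>k\<in>J. measure L {z \<in> S. f k w z \<in> A k} / measure L S)"
          unfolding eD[OF w] by (simp cong: conj_cong)
        moreover have "V.prob (f k w -` A k \<inter> space V) = measure L {z \<in> S. f k w z \<in> A k} / measure L S"
          if "k \<in> J" for k
          using prob[of "{k}" A] that A G by auto
        ultimately show "V.prob (\<Inter>j\<in>J. f j w -` A j \<inter> space V) =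
            (\<Prod>j\<in>J. V.prob (f j w -` A j \<inter> space V))"
          using prob[of J A] J A G by auto
      qed
    qed (use rv in \<open>auto simp: G_def\<close>)
    show ?case
    proof (intro allI impI)
      fix B assume B: "\<forall>k\<in>J. B k \<in> sets (borel :: real measure)"
      have "V.prob (\<Inter>j\<in>J. f j w -` B j \<inter> space V) = (\<Prod>j\<in>J. V.prob (f j w -` B j \<inter> space V))"
        using V.indep_varsD[OF ind J(2,1) subset_refl] B by auto
      moreover have "V.prob (f k w -` B k \<inter> space V) = measure L {z \<in> S. f k w z \<in> B k} / measure L S"
        if "k \<in> J" for k
        using prob[of "{k}" B] that B by auto
      ultimately show "measure L {z \<in> S. \<forall>k\<in>J. f k (W \<omega>) z \<in> B k} / measure L S =
          (\<Prod>k\<in>J. measure L {z \<in> S. f k (W \<omega>) z \<in> B k} / measure L S)"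
        using prob[of J B] J B by (simp add: w_def)
    qed
  qed
qed

section \<open>The p-value as a function of treatment and outcomes\<close>

lemma distr_pair_indep:
  assumes M: "prob_space M" and X: "X \<in> measurable M N" and Y: "Y \<in> measurable M L"
    and ind: "prob_space.indep_set M (sets (sigma_of M X N)) (sets (sigma_of M Y L))"
  shows "distr M (N \<Otimes>\<^sub>M L) (\<lambda>\<omega>. (X \<omega>, Y \<omega>)) = distr M N X \<Otimes>\<^sub>M distr M L Y"
proof -
  interpret prob_space M by fact
  show ?thesis
  proof (rule pair_measure_eqI[symmetric])
    show "sigma_finite_measure (distr M N X)" "sigma_finite_measure (distr M L Y)"
      using prob_space_distr[OF X] prob_space_distr[OF Y] by (auto intro: prob_space_imp_sigma_finite)
    show "sets (distr M N X \<Otimes>\<^sub>M distr M L Y) = sets (distr M (N \<Otimes>\<^sub>M L) (\<lambda>\<omega>. (X \<omega>, Y \<omega>)))"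
      by (simp cong: sets_pair_measure_cong)
    fix A B assume "A \<in> sets (distr M N X)" "B \<in> sets (distr M L Y)"
    then have AB: "A \<in> sets N" "B \<in> sets L" by auto
    have "prob ((X -` A \<inter> space M) \<inter> (Y -` B \<inter> space M)) = prob (X -` A \<inter> space M) * prob (Y -` B \<inter> space M)"
      by (rule indep_setD[OF ind]) (use AB in \<open>auto intro: in_vimage_algebra\<close>)
    also have "(X -` A \<inter> space M) \<inter> (Y -` B \<inter> space M) = (\<lambda>\<omega>. (X \<omega>, Y \<omega>)) -` (A \<times> B) \<inter> space M"
      by auto
    finally show "emeasure (distr M N X) A * emeasure (distr M L Y) B =
        emeasure (distr M (N \<Otimes>\<^sub>M L) (\<lambda>\<omega>. (X \<omega>, Y \<omega>))) (A \<times> B)"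
      using AB X Y by (simp add: emeasure_distr emeasure_eq_measure ennreal_mult')
  qed
qed

text \<open>As \<open>Z\<close> is independent of \<open>W\<close>, the conditional law of the copy
  given \<open>W\<close> is constantly the law of \<open>Z\<close>. Conditional independence with a
  constant conditional law makes the copy independent of the pair of \<open>Z\<close> and
  \<open>W\<close>.\<close>

lemma distr_pair_copy:
  assumes M: "prob_space M" and Z: "Z \<in> measurable M MZ" and W: "W \<in> measurable M MW"
    and ind: "prob_space.indep_set M (sets (sigma_of M Z MZ)) (sets (sigma_of M W MW))"
    and copy: "cond_indep_copy M MZ MW Z W Zs"
  shows "distr M ((MZ \<Otimes>\<^sub>M MW) \<Otimes>\<^sub>M distr M MZ Z) (\<lambda>\<omega>. ((Z \<omega>, W \<omega>), Zs \<omega>)) =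
    distr M (MZ \<Otimes>\<^sub>M MW) (\<lambda>\<omega>. (Z \<omega>, W \<omega>)) \<Otimes>\<^sub>M distr M MZ Z"
proof -
  interpret prob_space M by fact
  have Zs: "Zs \<in> measurable M MZ" using copy by (simp add: cond_indep_copy_def)
  have [measurable]: "Z \<in> measurable M MZ" "W \<in> measurable M MW" "Zs \<in> measurable M MZ" by fact+
  let ?F = "sigma_of M W MW"
  note F = subalgebra_vimage_algebra[OF W]
  let ?m = "\<lambda>A. prob (Z -` A \<inter> space M)"
  have ZW: "prob (Z -` A \<inter> W -` C \<inter> space M) = ?m A * prob (W -` C \<inter> space M)"
    if "A \<in> sets MZ" "C \<in> sets MW" for A C
  proof -
    have "prob ((Z -` A \<inter> space M) \<inter> (W -` C \<inter> space M)) = ?m A * prob (W -` C \<inter> space M)"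
      by (rule indep_setD[OF ind]) (use that in \<open>auto intro: in_vimage_algebra\<close>)
    also have "(Z -` A \<inter> space M) \<inter> (W -` C \<inter> space M) = Z -` A \<inter> W -` C \<inter> space M" by auto
    finally show ?thesis .
  qed
  have cpZ: "AE \<omega> in M. cond_probability M ?F (\<lambda>\<omega>. Z \<omega> \<in> A) \<omega> = ?m A" if A: "A \<in> sets MZ" for A
  proof (rule cond_probability_eqI[OF finite_measure_axioms W, where g = "\<lambda>_. ?m A"])
    have [measurable]: "A \<in> sets MZ" by fact
    show "{\<omega> \<in> space M. Z \<omega> \<in> A} \<in> events" by measurable
    fix C assume C: "C \<in> sets MW"
    have [measurable]: "C \<in> sets MW" by fact
    have "{\<omega> \<in> space M. Z \<omega> \<in> A \<and> W \<omega> \<in> C} = Z -` A \<inter> W -` C \<inter> space M" by auto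
    then have "emeasure M {\<omega> \<in> space M. Z \<omega> \<in> A \<and> W \<omega> \<in> C} = ennreal (?m A) * emeasure M (W -` C \<inter> space M)"
      using ZW[OF A C] by (simp add: emeasure_eq_measure ennreal_mult')
    also have "\<dots> = (\<integral>\<^sup>+\<omega>. ennreal (?m A) * indicator (W -` C \<inter> space M) \<omega> \<partial>M)"
      by (simp add: nn_integral_cmult_indicator)
    also have "\<dots> = (\<integral>\<^sup>+\<omega>. ennreal (?m A) * indicator C (W \<omega>) \<partial>M)"
      by (intro nn_integral_cong) (auto simp: indicator_def)
    finally show "emeasure M {\<omega> \<in> space M. Z \<omega> \<in> A \<and> W \<omega> \<in> C} =
      (\<integral>\<^sup>+\<omega>. ennreal (?m A) * indicator C (W \<omega>) \<partial>M)" .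
  qed auto
  \<comment> \<open>The conditional probability of the joint event is the constant
    \<open>?m A * ?m B\<close>, so integrating it over \<open>W \<in> C\<close> only multiplies by
    the probability of that event.\<close>
  have triple: "prob (Z -` A \<inter> W -` C \<inter> Zs -` B \<inter> space M) =
      ?m A * ?m B * prob (W -` C \<inter> space M)"
    if A: "A \<in> sets MZ" and B: "B \<in> sets MZ" and C: "C \<in> sets MW" for A B C
  proof -
    have [measurable]: "A \<in> sets MZ" "B \<in> sets MZ" "C \<in> sets MW" by fact+
    let ?Q = "\<lambda>\<omega>. Z \<omega> \<in> A \<and> Zs \<omega> \<in> B"
    have all_bool: "(\<lambda>\<omega>. \<forall>b\<in>UNIV. case_bool Z Zs b \<omega> \<in> case_bool A B b) = ?Q"
      by (auto simp: fun_eq_iff split: bool.split)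
    have "\<forall>b\<in>UNIV. case_bool A B b \<in> sets MZ" using A B by (auto split: bool.split)
    then have "AE \<omega> in M. cond_probability M ?F (\<lambda>\<omega>. \<forall>b\<in>UNIV. case_bool Z Zs b \<omega> \<in> case_bool A B b) \<omega> =
        (\<Prod>b\<in>UNIV. cond_probability M ?F (\<lambda>\<omega>. case_bool Z Zs b \<omega> \<in> case_bool A B b) \<omega>)"
      using copy unfolding cond_indep_copy_def cond_indep_vars_def by blast
    then have "AE \<omega> in M. cond_probability M ?F ?Q \<omega> =
        cond_probability M ?F (\<lambda>\<omega>. Z \<omega> \<in> A) \<omega> * cond_probability M ?F (\<lambda>\<omega>. Zs \<omega> \<in> B) \<omega>"
      unfolding all_bool by (simp add: UNIV_bool mult.commute)
    moreover have "AE \<omega> in M. cond_probability M ?F (\<lambda>\<omega>. Zs \<omega> \<in> B) \<omega> =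
        cond_probability M ?F (\<lambda>\<omega>. Z \<omega> \<in> B) \<omega>"
      using copy B unfolding cond_indep_copy_def same_cond_distr_def by blast
    ultimately have ae: "AE \<omega> in M. cond_probability M ?F ?Q \<omega> = ?m A * ?m B"
      using cpZ[OF A] cpZ[OF B] by eventually_elim simp
    let ?C = "W -` C \<inter> space M"
    have Q: "{\<omega> \<in> space M. ?Q \<omega>} \<in> events" by measurable
    have CF: "?C \<in> sets ?F" using C by (rule in_vimage_algebra)
    have "prob {\<omega> \<in> ?C. ?Q \<omega>} = (\<integral>\<omega>\<in>?C. cond_probability M ?F ?Q \<omega> \<partial>M)"
      by (rule integral_cond_probability[OF finite_measure_axioms F Q CF, symmetric])
    also have "\<dots> = (\<integral>\<omega>\<in>?C. ?m A * ?m B \<partial>M)"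
    proof (rule set_lebesgue_integral_cong_AE)
      show "AE \<omega>\<in>?C in M. cond_probability M ?F ?Q \<omega> = ?m A * ?m B"
        using ae by eventually_elim simp
      show "cond_probability M ?F ?Q \<in> borel_measurable M"
        using measurable_from_subalg[OF F cond_probability_measurable[OF finite_measure_axioms F Q]] .
    qed measurable
    also have "\<dots> = ?m A * ?m B * prob ?C"
      unfolding set_lebesgue_integral_def by simp
    also have "{\<omega> \<in> ?C. ?Q \<omega>} = Z -` A \<inter> W -` C \<inter> Zs -` B \<inter> space M" by auto
    finally show ?thesis .
  qed
  have mB: "prob (Zs -` B \<inter> space M) = ?m B" if B: "B \<in> sets MZ" for B
  proof -
    have "Z -` space MZ \<inter> W -` space MW \<inter> Zs -` B \<inter> space M = Zs -` B \<inter> space M"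
      "Z -` space MZ \<inter> space M = space M" "W -` space MW \<inter> space M = space M"
      using measurable_space[OF Z] measurable_space[OF W] by auto
    then show ?thesis using triple[OF sets.top B sets.top] prob_space by simp
  qed
  \<comment> \<open>These families are closed under intersection and generate the sigma-algebras of
    the pair and of the copy, so independence needs checking only on them, where it is
    \<open>triple\<close>.\<close>
  let ?A = "{Z -` A \<inter> W -` C \<inter> space M | A C. A \<in> sets MZ \<and> C \<in> sets MW}"
  let ?B = "{Zs -` B \<inter> space M | B. B \<in> sets MZ}"
  have "indep_set ?A ?B"
    unfolding indep_sets2_eq
  proof (intro conjI ballI)
    fix a b assume "a \<in> ?A" "b \<in> ?B"
    then obtain A C B where ab: "A \<in> sets MZ" "C \<in> sets MW" "B \<in> sets MZ"
      "a = Z -` A \<inter> W -` C \<inter> space M" "b = Zs -` B \<inter> space M" by blast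
    have "a \<inter> b = Z -` A \<inter> W -` C \<inter> Zs -` B \<inter> space M" using ab by auto
    then show "prob (a \<inter> b) = prob a * prob b"
      using triple[OF ab(1,3,2)] ZW[OF ab(1,2)] mB[OF ab(3)] ab(4,5) by simp
  next
    show "?A \<subseteq> events" using Z W by (auto simp: Int_assoc[symmetric] intro!: measurable_sets)
    show "?B \<subseteq> events" using Zs by (auto intro!: measurable_sets)
  qed
  moreover have "Int_stable ?A"
  proof (rule Int_stableI)
    fix a b assume "a \<in> ?A" "b \<in> ?A"
    then obtain A C A' C' where ab: "A \<in> sets MZ" "C \<in> sets MW" "A' \<in> sets MZ" "C' \<in> sets MW"
      "a = Z -` A \<inter> W -` C \<inter> space M" "b = Z -` A' \<inter> W -` C' \<inter> space M" by blast
    then have "a \<inter> b = Z -` (A \<inter> A') \<inter> W -` (C \<inter> C') \<inter> space M" by auto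
    then show "a \<inter> b \<in> ?A" using ab by blast
  qed
  moreover have "Int_stable ?B"
  proof (rule Int_stableI)
    fix a b assume "a \<in> ?B" "b \<in> ?B"
    then obtain A A' where ab: "A \<in> sets MZ" "A' \<in> sets MZ"
      "a = Zs -` A \<inter> space M" "b = Zs -` A' \<inter> space M" by blast
    then have "a \<inter> b = Zs -` (A \<inter> A') \<inter> space M" by auto
    then show "a \<inter> b \<in> ?B" using ab by blast
  qed
  ultimately have "indep_set (sigma_sets (space M) ?A) (sigma_sets (space M) ?B)"
    by (rule indep_set_sigma_sets)
  moreover have "sigma_sets (space M) ?B = sets (sigma_of M Zs MZ)"
    by (simp add: sets_vimage_algebra)
  moreover have "sigma_sets (space M) ?A = sets (sigma_of M (\<lambda>\<omega>. (Z \<omega>, W \<omega>)) (MZ \<Otimes>\<^sub>M MW))"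
  proof -
    let ?R = "{a \<times> b | a b. a \<in> sets MZ \<and> b \<in> sets MW}"
    let ?S = "space MZ \<times> space MW"
    have R: "?R \<subseteq> Pow ?S" using pair_measure_closed by blast
    have "sets (MZ \<Otimes>\<^sub>M MW) = sets (sigma ?S ?R)"
      using R by (simp add: sets_pair_measure)
    then have "sets (sigma_of M (\<lambda>\<omega>. (Z \<omega>, W \<omega>)) (MZ \<Otimes>\<^sub>M MW)) =
        sets (sigma_of M (\<lambda>\<omega>. (Z \<omega>, W \<omega>)) (sigma ?S ?R))"
      by (rule sets_vimage_algebra_cong)
    also have "\<dots> = sets (sigma (space M) {(\<lambda>\<omega>. (Z \<omega>, W \<omega>)) -` A \<inter> space M | A. A \<in> ?R})"
      using R measurable_space[OF Z] measurable_space[OF W] by (subst vimage_algebra_sigma) auto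
    also have "\<dots> = sigma_sets (space M) {(\<lambda>\<omega>. (Z \<omega>, W \<omega>)) -` A \<inter> space M | A. A \<in> ?R}"
      by (rule sets_measure_of) auto
    also have "{(\<lambda>\<omega>. (Z \<omega>, W \<omega>)) -` A \<inter> space M | A. A \<in> ?R} = ?A"
    proof -
      have "(\<lambda>\<omega>. (Z \<omega>, W \<omega>)) -` (A \<times> C) \<inter> space M = Z -` A \<inter> W -` C \<inter> space M" for A C by auto
      then show ?thesis by (auto; metis)
    qed
    finally show ?thesis by simp
  qed
  ultimately have "indep_set (sets (sigma_of M (\<lambda>\<omega>. (Z \<omega>, W \<omega>)) (MZ \<Otimes>\<^sub>M MW))) (sets (sigma_of M Zs MZ))"
    by simp
  then have "distr M ((MZ \<Otimes>\<^sub>M MW) \<Otimes>\<^sub>M MZ) (\<lambda>\<omega>. ((Z \<omega>, W \<omega>), Zs \<omega>)) =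
    distr M (MZ \<Otimes>\<^sub>M MW) (\<lambda>\<omega>. (Z \<omega>, W \<omega>)) \<Otimes>\<^sub>M distr M MZ Zs"
    by (intro distr_pair_indep[OF prob_space_axioms]) auto
  moreover have "distr M MZ Zs = distr M MZ Z"
    using mB by (intro measure_eqI) (auto simp: emeasure_distr emeasure_eq_measure)
  moreover have "distr M ((MZ \<Otimes>\<^sub>M MW) \<Otimes>\<^sub>M distr M MZ Z) (\<lambda>\<omega>. ((Z \<omega>, W \<omega>), Zs \<omega>)) =
      distr M ((MZ \<Otimes>\<^sub>M MW) \<Otimes>\<^sub>M MZ) (\<lambda>\<omega>. ((Z \<omega>, W \<omega>), Zs \<omega>))"
    by (intro distr_cong refl sets_pair_measure_cong) auto
  ultimately show ?thesis by simp
qed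

text \<open>The event that the copy falls into the block of \<open>Z\<close> depends on
  \<open>Z\<close>, but as a set \<open>E\<close> of triples it is fixed, and its section at
  \<open>(z, w)\<close> is the block of \<open>z\<close>, of positive probability. Hence
  \<open>cond_probability_product\<close>, with the pair of \<open>Z\<close> and \<open>W\<close> as
  conditioning variable, gives the ratio defining \<open>rand_p_value\<close>.\<close>

lemma
  fixes t :: "'z \<Rightarrow> 'w \<Rightarrow> real"
  assumes M: "prob_space M" and Z: "Z \<in> measurable M MZ" and W: "W \<in> measurable M MW"
    and Zs: "Zs \<in> measurable M MZ"
    and law: "distr M ((MZ \<Otimes>\<^sub>M MW) \<Otimes>\<^sub>M distr M MZ Z) (\<lambda>\<omega>. ((Z \<omega>, W \<omega>), Zs \<omega>)) =
      distr M (MZ \<Otimes>\<^sub>M MW) (\<lambda>\<omega>. (Z \<omega>, W \<omega>)) \<Otimes>\<^sub>M distr M MZ Z"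
    and P: "finite P" "partition_on (space MZ) P" "P \<subseteq> sets MZ"
    and pos: "\<And>S. S \<in> P \<Longrightarrow> measure (distr M MZ Z) S > 0"
    and t: "(\<lambda>(z, w). t z w) \<in> borel_measurable (MZ \<Otimes>\<^sub>M MW)"
  shows p_value_eq: "AE \<omega> in M. p_value M MZ MW Z W Zs P t \<omega> =
      rand_p_value (distr M MZ Z) P (\<lambda>z. t z (W \<omega>)) (Z \<omega>)"
    and p_value_measurable: "p_value M MZ MW Z W Zs P t \<in> borel_measurable M"
    and rand_p_value_measurable:
      "(\<lambda>(z, w). rand_p_value (distr M MZ Z) P (\<lambda>x. t x w) z) \<in> borel_measurable (MZ \<Otimes>\<^sub>M MW)"
proof -
  interpret M: prob_space M by fact
  define \<mu> where "\<mu> = distr M MZ Z"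
  interpret \<mu>: prob_space \<mu> unfolding \<mu>_def by (rule M.prob_space_distr[OF Z])
  have s\<mu> [measurable_cong]: "sets \<mu> = sets MZ" and sp\<mu>: "space \<mu> = space MZ" by (auto simp: \<mu>_def)
  have [measurable]: "Z \<in> measurable M MZ" "W \<in> measurable M MW" "Zs \<in> measurable M MZ" by fact+
  let ?N = "MZ \<Otimes>\<^sub>M MW"
  let ?T = "?N \<Otimes>\<^sub>M \<mu>"
  have t1: "(\<lambda>p. t (fst p) (snd p)) \<in> borel_measurable ?N" using t by (simp add: case_prod_beta')
  have "(\<lambda>p. (snd p, snd (fst p))) \<in> measurable ?T ?N" by measurable
  from measurable_compose[OF this t1]
  have [measurable]: "(\<lambda>p. t (snd p) (snd (fst p))) \<in> borel_measurable ?T" by simp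
  from measurable_compose[OF measurable_fst[of ?N \<mu>] t1]
  have [measurable]: "(\<lambda>p. t (fst (fst p)) (snd (fst p))) \<in> borel_measurable ?T" by simp
  define E where "E = {p \<in> space ?T. snd p \<in> cell P (fst (fst p))}"
  define D where "D = {p \<in> space ?T. t (snd p) (snd (fst p)) \<le> t (fst (fst p)) (snd (fst p))}"
  have D: "D \<in> sets ?T" unfolding D_def by measurable
  have "E = (\<Union>S\<in>P. {p \<in> space ?T. fst (fst p) \<in> S \<and> snd p \<in> S})"
  proof (intro set_eqI iffI)
    fix p assume p: "p \<in> E"
    then have "fst (fst p) \<in> space MZ" by (auto simp: E_def space_pair_measure)
    from cell_in[OF P(2) this] mem_cell[OF P(2) this] p
    show "p \<in> (\<Union>S\<in>P. {p \<in> space ?T. fst (fst p) \<in> S \<and> snd p \<in> S})"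
      unfolding E_def by blast
  next
    fix p assume "p \<in> (\<Union>S\<in>P. {p \<in> space ?T. fst (fst p) \<in> S \<and> snd p \<in> S})"
    then obtain S where "S \<in> P" "p \<in> space ?T" "fst (fst p) \<in> S" "snd p \<in> S" by blast
    then show "p \<in> E" using cell_eq[OF P(2), of S "fst (fst p)"] by (simp add: E_def)
  qed
  also have "\<dots> \<in> sets ?T"
  proof (rule sets.finite_UN[OF P(1)])
    fix S assume "S \<in> P"
    then have [measurable]: "S \<in> sets MZ" using P(3) by auto
    show "{p \<in> space ?T. fst (fst p) \<in> S \<and> snd p \<in> S} \<in> sets ?T" by measurable
  qed
  finally have E: "E \<in> sets ?T" .
  have DE: "D \<inter> E \<in> sets ?T" using D E by blast
  have cs: "cell P z \<subseteq> space MZ" if "z \<in> space MZ" for z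
    using cell_in[OF P(2) that] P(3) sets.sets_into_space by blast
  have sE: "Pair (z, w) -` E = cell P z" and
    sDE: "Pair (z, w) -` (D \<inter> E) = {x \<in> cell P z. t x w \<le> t z w}"
    if "z \<in> space MZ" "w \<in> space MW" for z w
    using that cs by (auto simp: E_def D_def space_pair_measure sp\<mu>)
  have r: "measure \<mu> (Pair (z, w) -` (D \<inter> E)) / measure \<mu> (Pair (z, w) -` E) =
      rand_p_value \<mu> P (\<lambda>x. t x w) z" if "z \<in> space MZ" "w \<in> space MW" for z w
    using sE[OF that] sDE[OF that] by (simp add: rand_p_value_def)
  have "(\<lambda>y. measure \<mu> (Pair y -` (D \<inter> E)) / measure \<mu> (Pair y -` E)) \<in> borel_measurable ?N"
    unfolding measure_def using \<mu>.measurable_emeasure_Pair[OF E] \<mu>.measurable_emeasure_Pair[OF DE]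
    by measurable
  then show "(\<lambda>(z, w). rand_p_value (distr M MZ Z) P (\<lambda>x. t x w) z) \<in> borel_measurable ?N"
    unfolding \<mu>_def[symmetric]
    by (subst measurable_cong[where g = "\<lambda>y. measure \<mu> (Pair y -` (D \<inter> E)) / measure \<mu> (Pair y -` E)"])
      (auto simp: r[symmetric] space_pair_measure)
  have Y: "(\<lambda>\<omega>. (Z \<omega>, W \<omega>)) \<in> measurable M ?N" by measurable
  have X: "Zs \<in> measurable M \<mu>" using Zs by (simp add: \<mu>_def)
  let ?U = "uniform_measure M {\<omega> \<in> space M. Zs \<omega> \<in> cell P (Z \<omega>)}"
  have EE: "{\<omega> \<in> space M. ((Z \<omega>, W \<omega>), Zs \<omega>) \<in> E} = {\<omega> \<in> space M. Zs \<omega> \<in> cell P (Z \<omega>)}"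
    using measurable_space[OF Y] measurable_space[OF X] by (auto simp: E_def space_pair_measure)
  have DD: "{\<omega> \<in> space ?U. ((Z \<omega>, W \<omega>), Zs \<omega>) \<in> D} = {\<omega> \<in> space ?U. t (Zs \<omega>) (W \<omega>) \<le> t (Z \<omega>) (W \<omega>)}"
    using measurable_space[OF Y] measurable_space[OF X] by (auto simp: D_def space_pair_measure)
  have pv: "p_value M MZ MW Z W Zs P t = cond_probability ?U
      (sigma_of M (\<lambda>\<omega>. (Z \<omega>, W \<omega>)) ?N) (\<lambda>\<omega>. ((Z \<omega>, W \<omega>), Zs \<omega>) \<in> D)"
    unfolding p_value_def cond_probability_def DD ..
  have "AE \<omega> in M. p_value M MZ MW Z W Zs P t \<omega> =
      measure \<mu> (Pair (Z \<omega>, W \<omega>) -` (D \<inter> E)) / measure \<mu> (Pair (Z \<omega>, W \<omega>) -` E)"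
    unfolding pv EE[symmetric]
  proof (rule cond_probability_product[OF M \<mu>.prob_space_axioms Y X _ D E])
    show "distr M ?T (\<lambda>\<omega>. ((Z \<omega>, W \<omega>), Zs \<omega>)) = distr M ?N (\<lambda>\<omega>. (Z \<omega>, W \<omega>)) \<Otimes>\<^sub>M \<mu>"
      unfolding \<mu>_def by (rule law)
    fix y assume "y \<in> space ?N"
    then obtain z w where "y = (z, w)" "z \<in> space MZ" "w \<in> space MW"
      by (auto simp: space_pair_measure)
    then show "0 < measure \<mu> (Pair y -` E)"
      using sE pos[OF cell_in[OF P(2)]] by (simp add: \<mu>_def)
  qed
  with AE_space show "AE \<omega> in M. p_value M MZ MW Z W Zs P t \<omega> =
      rand_p_value (distr M MZ Z) P (\<lambda>z. t z (W \<omega>)) (Z \<omega>)"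
  proof eventually_elim
    case (elim \<omega>)
    then show ?case
      using r[OF measurable_space[OF Z elim(1)] measurable_space[OF W elim(1)]] by (simp add: \<mu>_def)
  qed
  have "{\<omega> \<in> space M. Zs \<omega> \<in> cell P (Z \<omega>)} \<in> sets M"
    unfolding EE[symmetric] using E X by measurable
  have fin: "finite_measure ?U"
  proof
    have "{\<omega> \<in> space M. Zs \<omega> \<in> cell P (Z \<omega>)} \<inter> space M = {\<omega> \<in> space M. Zs \<omega> \<in> cell P (Z \<omega>)}"
      by auto
    then show "emeasure ?U (space ?U) \<noteq> \<infinity>"
      using \<open>_ \<in> sets M\<close> by (simp add: ennreal_divide_eq_top_iff)
  qed
  have YU: "(\<lambda>\<omega>. (Z \<omega>, W \<omega>)) \<in> measurable ?U ?N" using Y by simp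
  \<comment> \<open>The final event is defined by the p-values themselves and not by the explicit
    ratio, so the version also has to be measurable.\<close>
  have "p_value M MZ MW Z W Zs P t \<in> borel_measurable (sigma_of M (\<lambda>\<omega>. (Z \<omega>, W \<omega>)) ?N)"
    unfolding pv
  proof (rule cond_probability_measurable[OF fin])
    show "subalgebra ?U (sigma_of M (\<lambda>\<omega>. (Z \<omega>, W \<omega>)) ?N)"
      using subalgebra_vimage_algebra[OF YU] by simp
    show "{\<omega> \<in> space ?U. ((Z \<omega>, W \<omega>), Zs \<omega>) \<in> D} \<in> sets ?U"
      using D X by simp
  qed
  then show "p_value M MZ MW Z W Zs P t \<in> borel_measurable M"
    by (rule measurable_from_subalg[OF subalgebra_vimage_algebra[OF Y]])
qed

section \<open>The main bound\<close>

theorem theorem3: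
  fixes M :: "'a measure"
    and MZ \<nu> :: "'z measure" and MW :: "'w measure"
    and Z Zs :: "'a \<Rightarrow> 'z" and W :: "'a \<Rightarrow> 'w"
    and \<pi> :: "'z \<Rightarrow> real"
    and K :: nat
    and R :: "nat \<Rightarrow> 'z set set"
    and t :: "nat \<Rightarrow> 'z \<Rightarrow> 'w \<Rightarrow> real"
    and \<alpha> :: "nat \<Rightarrow> real"
  assumes prob: "prob_space M"
    and Z: "Z \<in> measurable M MZ"
    and W: "W \<in> measurable M MW"
    and indep: "prob_space.indep_set M (sets (sigma_of M Z MZ)) (sets (sigma_of M W MW))"
    and ref_measure: "sets \<nu> = sets MZ"
    and density: "distributed M \<nu> Z (\<lambda>z. ennreal (\<pi> z))"
    and density_pos: "\<forall>z\<in>space MZ. \<pi> z > 0"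
    and copy: "cond_indep_copy M MZ MW Z W Zs"
    and K: "K \<ge> 1"
    and partition: "\<forall>k\<in>{1..K}. finite (R k) \<and> partition_on (space MZ) (R k) \<and> R k \<subseteq> sets MZ"
    and cell_pos: "\<forall>S\<in>union_family R {1..K}. measure M {\<omega> \<in> space M. Z \<omega> \<in> S} > 0"
    and statistic: "\<forall>k\<in>{1..K}. (\<lambda>(z, w). t k z w) \<in> borel_measurable (MZ \<Otimes>\<^sub>M MW)"
    and a: "\<forall>j\<in>{1..K}. \<forall>k\<in>{1..K}. j \<noteq> k \<longrightarrow>
              refinement (space MZ) R {j, k} \<subseteq> union_family R {j, k}"
    and b: "\<forall>J. J \<subseteq> {1..K} \<and> J \<noteq> {} \<longrightarrow>
              (\<forall>S\<in>refinement (space MZ) R J.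
                 cond_indep_vars (uniform_measure M {\<omega> \<in> space M. Z \<omega> \<in> S}) (sigma_of M W MW)
                   (\<lambda>_. borel) (\<lambda>j \<omega>. t j (Z \<omega>) (W \<omega>)) J)"
    and \<alpha>: "\<forall>k\<in>{1..K}. \<alpha> k \<in> {0..1}"
  shows "(AE \<omega> in M.
            cond_probability M
              (sigma_of_pair M Z (sigma (space MZ) (coarsening (space MZ) R {1..K})) W MW)
              (\<lambda>\<omega>. \<forall>k\<in>{1..K}. p_value M MZ MW Z W Zs (R k) (t k) \<omega> \<le> \<alpha> k) \<omega>
            \<le> (\<Prod>k=1..K. \<alpha> k))
       \<and> (AE \<omega> in M.
            cond_probability M (sigma_of M W MW)
              (\<lambda>\<omega>. \<forall>k\<in>{1..K}. p_value M MZ MW Z W Zs (R k) (t k) \<omega> \<le> \<alpha> k) \<omega>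
            \<le> (\<Prod>k=1..K. \<alpha> k))"
proof -
  interpret M: prob_space M by fact
  define I where "I = {1..K}"
  have I: "finite I" "I \<noteq> {}" using K by (auto simp: I_def)
  define \<mu> where "\<mu> = distr M MZ Z"
  interpret \<mu>: prob_space \<mu> unfolding \<mu>_def by (rule M.prob_space_distr[OF Z])
  have s\<mu> [measurable_cong]: "sets \<mu> = sets MZ" and sp\<mu>: "space \<mu> = space MZ" by (auto simp: \<mu>_def)
  have Zs: "Zs \<in> measurable M MZ" using copy by (simp add: cond_indep_copy_def)
  have [measurable]: "Z \<in> measurable M MZ" "W \<in> measurable M MW" by fact+
  have Z\<mu>: "Z \<in> measurable M \<mu>" using Z by (simp add: \<mu>_def)
  have fin: "finite (R k)" and part: "partition_on (space MZ) (R k)" and Rs: "R k \<subseteq> sets MZ"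
    and tm: "(\<lambda>(z, w). t k z w) \<in> borel_measurable (MZ \<Otimes>\<^sub>M MW)" and \<alpha>0: "0 \<le> \<alpha> k"
    if "k \<in> I" for k
    using that partition statistic \<alpha> by (auto simp: I_def)
  have pos: "measure \<mu> S > 0" if "k \<in> I" "S \<in> R k" for k S
  proof -
    have "measure \<mu> S = measure M {\<omega> \<in> space M. Z \<omega> \<in> S}"
      using Rs[OF that(1)] that(2) unfolding \<mu>_def
      by (subst measure_distr) (auto intro!: arg_cong[of _ _ "measure M"])
    then show ?thesis using cell_pos that by (auto simp: union_family_def I_def)
  qed
  have law: "distr M (MW \<Otimes>\<^sub>M \<mu>) (\<lambda>\<omega>. (W \<omega>, Z \<omega>)) = distr M MW W \<Otimes>\<^sub>M \<mu>"
  proof -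
    have "M.indep_set (sets (sigma_of M W MW)) (sets (sigma_of M Z MZ))"
      using indep unfolding M.indep_sets2_eq by (metis Int_commute mult.commute)
    then have "distr M (MW \<Otimes>\<^sub>M MZ) (\<lambda>\<omega>. (W \<omega>, Z \<omega>)) = distr M MW W \<Otimes>\<^sub>M \<mu>"
      unfolding \<mu>_def by (rule distr_pair_indep[OF prob W Z])
    moreover have "distr M (MW \<Otimes>\<^sub>M \<mu>) (\<lambda>\<omega>. (W \<omega>, Z \<omega>)) = distr M (MW \<Otimes>\<^sub>M MZ) (\<lambda>\<omega>. (W \<omega>, Z \<omega>))"
      by (intro distr_cong refl sets_pair_measure_cong s\<mu>)
    ultimately show ?thesis by simp
  qed
  note law3 = distr_pair_copy[OF prob Z W indep copy]
  have pv: "AE \<omega> in M. p_value M MZ MW Z W Zs (R k) (t k) \<omega> =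
      rand_p_value \<mu> (R k) (\<lambda>z. t k z (W \<omega>)) (Z \<omega>)"
    and pvm: "p_value M MZ MW Z W Zs (R k) (t k) \<in> borel_measurable M"
    and rm: "(\<lambda>(z, w). rand_p_value \<mu> (R k) (\<lambda>x. t k x w) z) \<in> borel_measurable (MZ \<Otimes>\<^sub>M MW)"
    if k: "k \<in> I" for k
  proof -
    note args = prob Z W Zs law3 fin[OF k] part[OF k] Rs[OF k] pos[OF k, unfolded \<mu>_def] tm[OF k]
    show "AE \<omega> in M. p_value M MZ MW Z W Zs (R k) (t k) \<omega> =
        rand_p_value \<mu> (R k) (\<lambda>z. t k z (W \<omega>)) (Z \<omega>)"
      using p_value_eq[OF args] by (simp add: \<mu>_def)
    show "p_value M MZ MW Z W Zs (R k) (t k) \<in> borel_measurable M"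
      by (rule p_value_measurable[OF args])
    show "(\<lambda>(z, w). rand_p_value \<mu> (R k) (\<lambda>x. t k x w) z) \<in> borel_measurable (MZ \<Otimes>\<^sub>M MW)"
      using rand_p_value_measurable[OF args] by (simp add: \<mu>_def)
  qed
  have nest: "S \<subseteq> T \<or> T \<subseteq> S"
    if jk: "j \<in> I" "k \<in> I" and ST: "S \<in> R j" "T \<in> R k" "S \<inter> T \<noteq> {}" for j k S T
  proof (cases "j = k")
    case True
    then show ?thesis using ST partition_onD2[OF part[OF jk(2)]] by (auto simp: disjoint_def)
  next
    case False
    then have "refinement (space MZ) R {j, k} \<subseteq> union_family R {j, k}"
      using a jk by (auto simp: I_def)
    from refinement_subset_union_imp_nested[OF part part this, of S T] jk ST show ?thesis by auto
  qed
  \<comment> \<open>Intersecting with \<open>union_family R I\<close> leaves finitely many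
    \<open>S\<close>, each of positive probability, so one null set serves all \<open>J\<close>,
    \<open>S\<close> and Borel families.\<close>
  have "AE \<omega> in M. \<forall>J\<in>Pow I - {{}}. \<forall>S\<in>refinement (space MZ) R J \<inter> union_family R I.
      \<forall>B. (\<forall>k\<in>J. B k \<in> sets borel) \<longrightarrow>
      measure \<mu> {z \<in> S. \<forall>k\<in>J. t k z (W \<omega>) \<in> B k} / measure \<mu> S =
      (\<Prod>k\<in>J. measure \<mu> {z \<in> S. t k z (W \<omega>) \<in> B k} / measure \<mu> S)"
  proof (intro AE_finite_allI)
    show "finite (Pow I - {{}})" using I by simp
    fix J assume J: "J \<in> Pow I - {{}}"
    show "finite (refinement (space MZ) R J \<inter> union_family R I)"
      using I fin by (auto simp: union_family_def)
    fix S assume S: "S \<in> refinement (space MZ) R J \<inter> union_family R I"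
    then obtain k where k: "k \<in> I" "S \<in> R k" by (auto simp: union_family_def)
    have ci: "cond_indep_vars (uniform_measure M {\<omega> \<in> space M. Z \<omega> \<in> S}) (sigma_of M W MW)
        (\<lambda>_. borel) (\<lambda>j \<omega>. t j (Z \<omega>) (W \<omega>)) J"
      using b J S by (auto simp: I_def)
    show "AE \<omega> in M. \<forall>B. (\<forall>k\<in>J. B k \<in> sets borel) \<longrightarrow>
      measure \<mu> {z \<in> S. \<forall>k\<in>J. t k z (W \<omega>) \<in> B k} / measure \<mu> S =
      (\<Prod>k\<in>J. measure \<mu> {z \<in> S. t k z (W \<omega>) \<in> B k} / measure \<mu> S)"
    proof (rule AE_product_rule[OF prob \<mu>.prob_space_axioms W Z\<mu> law, where f = "\<lambda>k w z. t k z w"])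
      show "S \<in> sets \<mu>" using Rs[OF k(1)] k(2) s\<mu> by auto
      show "measure \<mu> S > 0" by (rule pos[OF k])
      show "finite J" "J \<noteq> {}" using J I finite_subset by auto
      show "(\<lambda>(w, z). t k z w) \<in> borel_measurable (MW \<Otimes>\<^sub>M \<mu>)" if "k \<in> J" for k
      proof -
        have "(\<lambda>p. (snd p, fst p)) \<in> measurable (MW \<Otimes>\<^sub>M \<mu>) (MZ \<Otimes>\<^sub>M MW)" by measurable
        from measurable_compose[OF this tm[of k]] that J show ?thesis
          by (auto simp: case_prod_beta')
      qed
    qed (rule ci)
  qed
  with AE_space have nt: "AE \<omega> in M. nested_tests \<mu> I R (\<lambda>k z. t k z (W \<omega>))"
  proof eventually_elim
    case (elim \<omega>)
    note w = measurable_space[OF W elim(1)]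
    show ?case
    proof (rule nested_tests.intro[OF \<mu>.prob_space_axioms nested_tests_axioms.intro])
      show "finite I" by (rule I)
      show "finite (R k)" "partition_on (space \<mu>) (R k)" "R k \<subseteq> sets \<mu>" if "k \<in> I" for k
        using fin part Rs that by (auto simp: s\<mu> sp\<mu>)
      show "measure \<mu> S > 0" if "k \<in> I" "S \<in> R k" for k S using pos that .
      show "(\<lambda>z. t k z (W \<omega>)) \<in> borel_measurable \<mu>" if "k \<in> I" for k
        using measurable_compose[OF measurable_Pair2'[OF w] tm[OF that]]
        by (simp cong: measurable_cong_sets add: \<mu>_def)
      show "S \<subseteq> T \<or> T \<subseteq> S"
        if "j \<in> I" "k \<in> I" "S \<in> R j" "T \<in> R k" "S \<inter> T \<noteq> {}" for j k S T
        by (rule nest[OF that])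
      show "measure \<mu> {z \<in> S. \<forall>k\<in>J. t k z (W \<omega>) \<in> B k} / measure \<mu> S =
          (\<Prod>k\<in>J. measure \<mu> {z \<in> S. t k z (W \<omega>) \<in> B k} / measure \<mu> S)"
        if "J \<subseteq> I" "J \<noteq> {}" "S \<in> refinement (space \<mu>) R J" "S \<in> union_family R I"
          "\<And>k. k \<in> J \<Longrightarrow> B k \<in> sets borel" for J S B
        using elim(2) that by (simp add: sp\<mu>)
    qed
  qed
  define c where "c = (\<Prod>k\<in>I. \<alpha> k)"
  have c0: "0 \<le> c" unfolding c_def using \<alpha>0 by (intro prod_nonneg) auto
  define Q where "Q \<omega> \<longleftrightarrow> (\<forall>k\<in>I. p_value M MZ MW Z W Zs (R k) (t k) \<omega> \<le> \<alpha> k)" for \<omega>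
  \<comment> \<open>\<open>Q'\<close> is an explicit set of pairs whose sections can be examined for
    each value of \<open>W\<close>, while \<open>Q\<close> speaks of versions; they agree almost
    surely.\<close>
  define Q' where "Q' w z \<longleftrightarrow> (\<forall>k\<in>I. rand_p_value \<mu> (R k) (\<lambda>x. t k x w) z \<le> \<alpha> k)" for w z
  have "AE \<omega> in M. \<forall>k\<in>I. p_value M MZ MW Z W Zs (R k) (t k) \<omega> =
      rand_p_value \<mu> (R k) (\<lambda>z. t k z (W \<omega>)) (Z \<omega>)"
    using I(1) pv by (intro AE_finite_allI)
  then have QQ': "AE \<omega> in M. Q \<omega> \<longleftrightarrow> Q' (W \<omega>) (Z \<omega>)"
    by eventually_elim (simp add: Q_def Q'_def)
  have Qm: "{\<omega> \<in> space M. Q \<omega>} \<in> sets M"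
    unfolding Q_def using I(1) pvm by (intro sets.sets_Collect_finite_All) measurable
  have Q'm: "{p \<in> space (MW \<Otimes>\<^sub>M \<mu>). Q' (fst p) (snd p)} \<in> sets (MW \<Otimes>\<^sub>M \<mu>)"
    unfolding Q'_def
  proof (rule sets.sets_Collect_finite_All[OF _ I(1)])
    fix k assume k: "k \<in> I"
    have "(\<lambda>p. (snd p, fst p)) \<in> measurable (MW \<Otimes>\<^sub>M \<mu>) (MZ \<Otimes>\<^sub>M MW)" by measurable
    from measurable_compose[OF this rm[OF k]]
    have "(\<lambda>p. rand_p_value \<mu> (R k) (\<lambda>x. t k x (fst p)) (snd p)) \<in> borel_measurable (MW \<Otimes>\<^sub>M \<mu>)"
      by simp
    then show "{p \<in> space (MW \<Otimes>\<^sub>M \<mu>). rand_p_value \<mu> (R k) (\<lambda>x. t k x (fst p)) (snd p) \<le> \<alpha> k}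
        \<in> sets (MW \<Otimes>\<^sub>M \<mu>)" by measurable
  qed
  define G where "G = sigma (space MZ) (coarsening (space MZ) R I)"
  have cs: "coarsening (space MZ) R I \<subseteq> sets MZ"
  proof
    fix S assume "S \<in> coarsening (space MZ) R I"
    then obtain z where z: "z \<in> space MZ" "S = (\<Union>j\<in>I. cell (R j) z)" by (auto simp: coarsening_def)
    show "S \<in> sets MZ"
      unfolding z(2) using Rs cell_in[OF part z(1)] I(1) by (intro sets.finite_UN) auto
  qed
  have cP: "coarsening (space MZ) R I \<subseteq> Pow (space MZ)" using cs sets.space_closed by blast
  have spG: "space G = space MZ" unfolding G_def using cP by (rule space_measure_of)
  have sG: "sets G = sigma_sets (space MZ) (coarsening (space MZ) R I)"
    unfolding G_def using cP by (rule sets_measure_of)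
  have sGMZ: "sets G \<subseteq> sets MZ" unfolding sG using cs by (rule sets.sigma_sets_subset)
  have idG: "(\<lambda>x. x) \<in> measurable MZ G" using sGMZ by (intro measurableI) (auto simp: spG)
  have ZG: "Z \<in> measurable M G" using measurable_compose[OF Z idG] .
  have Y: "(\<lambda>\<omega>. (Z \<omega>, W \<omega>)) \<in> measurable M (G \<Otimes>\<^sub>M MW)" using ZG W by measurable
  \<comment> \<open>The inequality is proved by integrating over \<open>W\<close>. For almost every
    value of \<open>W\<close> the section of \<open>D\<close> lies in the sigma-algebra generated by
    the coarsest sets, where \<open>coarse_sigma_bound\<close> applies.\<close>
  have key: "measure M {\<omega> \<in> (\<lambda>\<omega>. (Z \<omega>, W \<omega>)) -` D \<inter> space M. Q \<omega>}
      \<le> c * measure M ((\<lambda>\<omega>. (Z \<omega>, W \<omega>)) -` D \<inter> space M)"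
    if D: "D \<in> sets (G \<Otimes>\<^sub>M MW)" for D
  proof -
    define D' where "D' = {p \<in> space (MW \<Otimes>\<^sub>M \<mu>). (snd p, fst p) \<in> D}"
    define E where "E = {p \<in> space (MW \<Otimes>\<^sub>M \<mu>). (snd p, fst p) \<in> D \<and> Q' (fst p) (snd p)}"
    have id\<mu>: "(\<lambda>x. x) \<in> measurable \<mu> G" using idG by (simp add: \<mu>_def)
    have "snd \<in> measurable (MW \<Otimes>\<^sub>M \<mu>) G" using measurable_compose[OF measurable_snd id\<mu>] .
    then have "(\<lambda>p. (snd p, fst p)) \<in> measurable (MW \<Otimes>\<^sub>M \<mu>) (G \<Otimes>\<^sub>M MW)" by measurable
    from measurable_sets[OF this D] have D': "D' \<in> sets (MW \<Otimes>\<^sub>M \<mu>)"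
      by (simp add: D'_def vimage_def Int_def conj_commute)
    have "E = D' \<inter> {p \<in> space (MW \<Otimes>\<^sub>M \<mu>). Q' (fst p) (snd p)}" by (auto simp: D'_def E_def)
    then have E: "E \<in> sets (MW \<Otimes>\<^sub>M \<mu>)" using D' Q'm by simp
    have WZ: "(\<lambda>\<omega>. (W \<omega>, Z \<omega>)) \<in> measurable M (MW \<Otimes>\<^sub>M \<mu>)" using W Z\<mu> by measurable
    have em: "emeasure M {\<omega> \<in> space M. (W \<omega>, Z \<omega>) \<in> H} = (\<integral>\<^sup>+\<omega>. emeasure \<mu> (Pair (W \<omega>) -` H) \<partial>M)"
      if H: "H \<in> sets (MW \<Otimes>\<^sub>M \<mu>)" for H
    proof -
      have "{\<omega> \<in> space M. (W \<omega>, Z \<omega>) \<in> H} = (\<lambda>\<omega>. (W \<omega>, Z \<omega>)) -` H \<inter> space M" by auto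
      then have "emeasure M {\<omega> \<in> space M. (W \<omega>, Z \<omega>) \<in> H} =
          emeasure (distr M (MW \<Otimes>\<^sub>M \<mu>) (\<lambda>\<omega>. (W \<omega>, Z \<omega>))) H"
        using WZ H by (simp add: emeasure_distr)
      also have "\<dots> = (\<integral>\<^sup>+w. emeasure \<mu> (Pair w -` H) \<partial>distr M MW W)"
        unfolding law using H by (intro \<mu>.emeasure_pair_measure_alt) (simp cong: sets_pair_measure_cong)
      also have "\<dots> = (\<integral>\<^sup>+\<omega>. emeasure \<mu> (Pair (W \<omega>) -` H) \<partial>M)"
        using \<mu>.measurable_emeasure_Pair[OF H] by (subst nn_integral_distr) auto
      finally show ?thesis .
    qed
    have le: "AE \<omega> in M. emeasure \<mu> (Pair (W \<omega>) -` E) \<le> ennreal c * emeasure \<mu> (Pair (W \<omega>) -` D')"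
      using nt AE_space
    proof eventually_elim
      case (elim \<omega>)
      note w = measurable_space[OF W elim(2)]
      interpret nested_tests \<mu> I R "\<lambda>k z. t k z (W \<omega>)" by (rule elim(1))
      define Dw where "Dw = (\<lambda>z. (z, W \<omega>)) -` D"
      have Dw: "Dw \<in> sigma_sets (space \<mu>) (coarsening (space \<mu>) R I)"
        unfolding sp\<mu> sG[symmetric] Dw_def by (rule sets_Pair2[OF D])
      have "Dw \<subseteq> space \<mu>" using sets.sets_into_space[OF sets_Pair2[OF D]] by (simp add: Dw_def spG sp\<mu>)
      then have "Pair (W \<omega>) -` D' = Dw"
        "Pair (W \<omega>) -` E = {z \<in> Dw. \<forall>k\<in>I. rejects \<alpha> k z}"
        using w by (auto simp: D'_def E_def Dw_def space_pair_measure Q'_def rejects_def)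
      moreover have "\<mu>.prob {z \<in> Dw. \<forall>k\<in>I. rejects \<alpha> k z} \<le> \<mu>.prob Dw * c"
        unfolding c_def by (rule coarse_sigma_bound[OF I(2) Dw]) (rule \<alpha>0)
      ultimately show ?case
        using c0 by (simp add: \<mu>.emeasure_eq_measure ennreal_mult'[symmetric] mult.commute)
    qed
    have "emeasure M {\<omega> \<in> space M. (W \<omega>, Z \<omega>) \<in> E} \<le>
        (\<integral>\<^sup>+\<omega>. ennreal c * emeasure \<mu> (Pair (W \<omega>) -` D') \<partial>M)"
      unfolding em[OF E] by (rule nn_integral_mono_AE[OF le])
    also have "\<dots> = ennreal c * emeasure M {\<omega> \<in> space M. (W \<omega>, Z \<omega>) \<in> D'}"
      unfolding em[OF D'] using measurable_compose[OF W \<mu>.measurable_emeasure_Pair[OF D']]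
      by (rule nn_integral_cmult)
    finally have "measure M {\<omega> \<in> space M. (W \<omega>, Z \<omega>) \<in> E} \<le> c * measure M {\<omega> \<in> space M. (W \<omega>, Z \<omega>) \<in> D'}"
      using c0 by (simp add: M.emeasure_eq_measure ennreal_mult'[symmetric])
    moreover have "{\<omega> \<in> space M. (W \<omega>, Z \<omega>) \<in> D'} = (\<lambda>\<omega>. (Z \<omega>, W \<omega>)) -` D \<inter> space M"
      using measurable_space[OF WZ] by (auto simp: D'_def)
    moreover have "measure M {\<omega> \<in> space M. (W \<omega>, Z \<omega>) \<in> E} =
        measure M {\<omega> \<in> (\<lambda>\<omega>. (Z \<omega>, W \<omega>)) -` D \<inter> space M. Q \<omega>}"
    proof (rule M.finite_measure_eq_AE)
      show "AE \<omega> in M. (\<omega> \<in> {\<omega> \<in> space M. (W \<omega>, Z \<omega>) \<in> E}) =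
          (\<omega> \<in> {\<omega> \<in> (\<lambda>\<omega>. (Z \<omega>, W \<omega>)) -` D \<inter> space M. Q \<omega>})"
        using QQ' AE_space
      proof eventually_elim
        case (elim \<omega>)
        then show ?case using measurable_space[OF WZ elim(2)] by (auto simp: E_def)
      qed
      show "{\<omega> \<in> space M. (W \<omega>, Z \<omega>) \<in> E} \<in> sets M"
        using measurable_sets[OF WZ E] by (simp add: vimage_def Int_def conj_commute)
      have "{\<omega> \<in> (\<lambda>\<omega>. (Z \<omega>, W \<omega>)) -` D \<inter> space M. Q \<omega>} =
          ((\<lambda>\<omega>. (Z \<omega>, W \<omega>)) -` D \<inter> space M) \<inter> {\<omega> \<in> space M. Q \<omega>}" by auto
      then show "{\<omega> \<in> (\<lambda>\<omega>. (Z \<omega>, W \<omega>)) -` D \<inter> space M. Q \<omega>} \<in> sets M"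
        using measurable_sets[OF Y D] Qm by simp
    qed
    ultimately show ?thesis by simp
  qed
  have "AE \<omega> in M. cond_probability M (sigma_of_pair M Z G W MW) Q \<omega> \<le> c"
  proof (rule cond_probability_le[OF M.finite_measure_axioms subalgebra_vimage_algebra[OF Y] Qm])
    fix A assume "A \<in> sets (sigma_of_pair M Z G W MW)"
    then obtain D where "D \<in> sets (G \<Otimes>\<^sub>M MW)" "A = (\<lambda>\<omega>. (Z \<omega>, W \<omega>)) -` D \<inter> space M"
      using measurable_space[OF Y] by (subst (asm) sets_vimage_algebra2) auto
    then show "measure M {\<omega> \<in> A. Q \<omega>} \<le> c * measure M A" using key by simp
  qed
  moreover have "AE \<omega> in M. cond_probability M (sigma_of M W MW) Q \<omega> \<le> c"
  proof (rule cond_probability_le[OF M.finite_measure_axioms subalgebra_vimage_algebra[OF W] Qm])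
    fix A assume "A \<in> sets (sigma_of M W MW)"
    then obtain C where C: "C \<in> sets MW" "A = W -` C \<inter> space M"
      using measurable_space[OF W] by (subst (asm) sets_vimage_algebra2) auto
    \<comment> \<open>Events about \<open>W\<close> alone are the case
      \<open>D = space G \<times> C\<close> of \<open>key\<close>, so the second bound needs no
      separate argument.\<close>
    have "A = (\<lambda>\<omega>. (Z \<omega>, W \<omega>)) -` (space G \<times> C) \<inter> space M"
      using measurable_space[OF ZG] by (auto simp: C(2))
    then show "measure M {\<omega> \<in> A. Q \<omega>} \<le> c * measure M A"
      using key[of "space G \<times> C"] C(1) by simp
  qed
  ultimately show ?thesis
    unfolding G_def Q_def c_def I_def by simp
qed

end
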